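(* Let $k$ be a field, $n\ge 1$, $\mathcal{A}=\mathcal{NC}_n$ the Nilcoxeter algebra over $k$, and $\pi:\mathcal{A}\to\mathcal{A}/[\mathcal{A},\mathcal{A}]_t$ the quotient map. Let $\mathcal{B}=\{\pi(T_w): w\in S_n,\ \pi(T_w)\neq 0\}$, and for $c\in\mathcal{B}$ let $$z_c=\sum_{w\in S_n,\ \pi(T_w)=c} T_{w^{-1}w_0},$$ where $w_0$ is the longest element of $S_n$, so that $\{z_c\}_{c\in\mathcal{B}}$ is a basis of $Z(\mathcal{NC}_n)$ containing the identity $1=z_{\pi(T_{w_0})}$. Then the multiplication table of $Z(\mathcal{NC}_n)$ in this basis is trivial: for all $c,c'\in\mathcal{B}$ with $z_c\neq 1$ and $z_{c'}\neq 1$ one has $z_cz_{c'}=0$.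
   Context: The Nilcoxeter algebra $\mathcal{NC}_n$ is the unital associative $k$-algebra generated by $T_1,\dots,T_{n-1}$ with relations $T_iT_{i+1}T_i=T_{i+1}T_iT_{i+1}$, $T_iT_j=T_jT_i$ for $|i-j|>1$, and $T_i^2=0$. It has a $k$-basis $\{T_w\}_{w\in S_n}$, where $T_w=T_{i_1}\cdots T_{i_l}$ for any reduced expression $w=s_{i_1}\cdots s_{i_l}$, $s_i=(i\;\,i+1)$. Let $f:\mathcal{A}\to\mathcal{A}$ be the algebra involution with $f(T_i)=T_{n-i}$ for $1\le i\le n-1$. The twisted commutator subspace $[\mathcal{A},\mathcal{A}]_t$ is the $k$-linear span of all elements $ab-bf(a)$, $a,b\in\mathcal{A}$. *)

theory Defs
  imports
    Complex_Main
    "HOL-Combinatorics.Permutations"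
    "HOL-Library.Poly_Mapping"
    "HOL-Library.Set_Algebras"
    "HOL-Library.Cardinality"
begin

text \<open>
  The rank \<open>n \<ge> 1\<close> is the cardinality of the finite index type \<open>'n\<close>; throughout, \<open>n\<close> is
  \<open>CARD('n)\<close>. The element type \<open>'n\<close> itself plays no other role.
\<close>

typedef ('n::finite) gen_word = "{ws :: nat list. set ws \<subseteq> {1..<CARD('n)}}"
  by (rule exI[of _ "[]"]) simp

setup_lifting type_definition_gen_word

instantiation gen_word :: (finite) monoid_add
begin

lift_definition zero_gen_word :: "'a gen_word" is "[]" by simp

lift_definition plus_gen_word :: "'a gen_word \<Rightarrow> 'a gen_word \<Rightarrow> 'a gen_word" is "(@)" by simp

instance by standard (transfer; simp)+

end

text \<open>
  \<open>gen_word\<close> is the free monoid, written additively as \<open>Poly_Mapping\<close> requires, so that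
  \<open>'n gen_word \<Rightarrow>\<^sub>0 'k\<close> with its convolution product is the free associative unital algebra.
  Letters outside the range \<open>1, \<dots>, n - 1\<close> are junk and never used.
\<close>

lift_definition letter :: "nat \<Rightarrow> 'n::finite gen_word"
  is "\<lambda>i. if i \<in> {1..<CARD('n)} then [i] else []"
  by auto

definition free_gen :: "nat \<Rightarrow> 'n::finite gen_word \<Rightarrow>\<^sub>0 'k::field"
  where "free_gen i = Poly_Mapping.single (letter i) 1"

definition free_scale :: "'k::field \<Rightarrow> ('n::finite gen_word \<Rightarrow>\<^sub>0 'k) \<Rightarrow> ('n gen_word \<Rightarrow>\<^sub>0 'k)"
  where "free_scale c p = Poly_Mapping.single 0 c * p"

inductive_set two_sided_ideal :: "'a::ring_1 set \<Rightarrow> 'a set" for R where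
  zero: "0 \<in> two_sided_ideal R"
| add: "x \<in> two_sided_ideal R \<Longrightarrow> r \<in> R \<Longrightarrow> x + a * r * b \<in> two_sided_ideal R"

definition nc_relators :: "('n::finite gen_word \<Rightarrow>\<^sub>0 'k::field) set" where
  "nc_relators =
     {free_gen i * free_gen (i + 1) * free_gen i
        - free_gen (i + 1) * free_gen i * free_gen (i + 1) | i. 1 \<le> i \<and> i + 1 < CARD('n)}
   \<union> {free_gen i * free_gen j - free_gen j * free_gen i | i j.
        i \<in> {1..<CARD('n)} \<and> j \<in> {1..<CARD('n)} \<and> \<bar>int i - int j\<bar> > 1}
   \<union> {free_gen i * free_gen i | i. i \<in> {1..<CARD('n)}}"

definition nc_rel :: "('n::finite gen_word \<Rightarrow>\<^sub>0 'k::field) \<Rightarrow> ('n gen_word \<Rightarrow>\<^sub>0 'k) \<Rightarrow> bool"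
  where "nc_rel x y \<longleftrightarrow> x - y \<in> two_sided_ideal nc_relators"

lemma two_sided_ideal_plus:
  assumes "y \<in> two_sided_ideal R" "x \<in> two_sided_ideal R"
  shows "x + y \<in> two_sided_ideal R"
  using assms
  by (induction rule: two_sided_ideal.induct)
    (auto simp: add.assoc[symmetric] intro: two_sided_ideal.intros)

lemma two_sided_ideal_mult:
  assumes "x \<in> two_sided_ideal R" shows "c * x * d \<in> two_sided_ideal R"
  using assms
proof (induction rule: two_sided_ideal.induct)
  case (add x r a b)
  have "c * x * d + (c * a) * r * (b * d) \<in> two_sided_ideal R"
    by (rule two_sided_ideal.add[OF add.IH add.hyps(2)])
  then show ?case by (simp add: algebra_simps)
qed (simp add: two_sided_ideal.zero)

lemma two_sided_ideal_left: "x \<in> two_sided_ideal R \<Longrightarrow> c * x \<in> two_sided_ideal R"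
  using two_sided_ideal_mult[of x R c 1] by simp

lemma two_sided_ideal_right: "x \<in> two_sided_ideal R \<Longrightarrow> x * c \<in> two_sided_ideal R"
  using two_sided_ideal_mult[of x R 1 c] by simp

lemma two_sided_ideal_uminus: "x \<in> two_sided_ideal R \<Longrightarrow> - x \<in> two_sided_ideal R"
  using two_sided_ideal_left[of x R "- 1"] by simp

lemma two_sided_ideal_base: "r \<in> R \<Longrightarrow> r \<in> two_sided_ideal R"
  using two_sided_ideal.add[OF two_sided_ideal.zero, of r R 1 1] by simp

lemma equivp_nc_rel: "equivp nc_rel"
proof (rule equivpI)
  show "reflp nc_rel"
    by (simp add: reflp_def nc_rel_def two_sided_ideal.zero)
  show "symp nc_rel"
    by (auto simp: symp_def nc_rel_def dest: two_sided_ideal_uminus)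
  show "transp nc_rel"
    by (auto simp: transp_def nc_rel_def dest: two_sided_ideal_plus)
qed

quotient_type (overloaded) ('n, 'k) nilcoxeter
  = "'n::finite gen_word \<Rightarrow>\<^sub>0 'k::field" / nc_rel
  by (rule equivp_nc_rel)

lemma gen_word_poly_induct [case_names zero single plus]:
  fixes p :: "'a \<Rightarrow>\<^sub>0 'b::ab_group_add"
  assumes "P 0" "\<And>w c. P (Poly_Mapping.single w c)" "\<And>p q. P p \<Longrightarrow> P q \<Longrightarrow> P (p + q)"
  shows "P p"
proof (induction p rule: Poly_Mapping.update_induct)
  case (update p a b)
  have "Poly_Mapping.update a b p = p + Poly_Mapping.single a b"
    using update(1)
    by (intro poly_mapping_eqI)
      (auto simp: Poly_Mapping.lookup_update lookup_add lookup_single in_keys_iff when_def)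
  then show ?case using assms update by simp
qed (simp add: assms)

lemma gen_word_add_eq_0: "u + v = 0 \<longleftrightarrow> u = 0 \<and> v = (0 :: 'n::finite gen_word)"
  by transfer simp

lemma const_coeff_mult:
  fixes p q :: "'n::finite gen_word \<Rightarrow>\<^sub>0 'k::field"
  shows "Poly_Mapping.lookup (p * q) 0 = Poly_Mapping.lookup p 0 * Poly_Mapping.lookup q 0"
proof (induction p rule: gen_word_poly_induct)
  case (single w c)
  show ?case
    by (induction q rule: gen_word_poly_induct)
      (auto simp: mult_single lookup_single when_def gen_word_add_eq_0 distrib_left lookup_add)
qed (auto simp: distrib_right lookup_add)

lemma letter_neq_0: "i \<in> {1..<CARD('n)} \<Longrightarrow> letter i \<noteq> (0 :: 'n::finite gen_word)"
  by transfer simp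

lemma const_coeff_relator:
  fixes r :: "'n::finite gen_word \<Rightarrow>\<^sub>0 'k::field"
  assumes "r \<in> nc_relators" shows "Poly_Mapping.lookup r 0 = 0"
  using assms letter_neq_0[where 'n = 'n]
  by (auto simp: nc_relators_def free_gen_def lookup_minus const_coeff_mult lookup_single when_def)

lemma const_coeff_ideal:
  fixes x :: "'n::finite gen_word \<Rightarrow>\<^sub>0 'k::field"
  assumes "x \<in> two_sided_ideal nc_relators" shows "Poly_Mapping.lookup x 0 = 0"
  using assms
  by (induction rule: two_sided_ideal.induct)
    (auto simp: lookup_add const_coeff_mult const_coeff_relator)

instantiation nilcoxeter :: (finite, field) ring_1
begin

lift_definition zero_nilcoxeter :: "('a, 'b) nilcoxeter" is 0 .

lift_definition plus_nilcoxeter ::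
  "('a, 'b) nilcoxeter \<Rightarrow> ('a, 'b) nilcoxeter \<Rightarrow> ('a, 'b) nilcoxeter" is "(+)"
  unfolding nc_rel_def by (metis add_diff_add two_sided_ideal_plus)

lift_definition uminus_nilcoxeter :: "('a, 'b) nilcoxeter \<Rightarrow> ('a, 'b) nilcoxeter" is uminus
  unfolding nc_rel_def by (metis minus_diff_minus two_sided_ideal_uminus)

lift_definition minus_nilcoxeter ::
  "('a, 'b) nilcoxeter \<Rightarrow> ('a, 'b) nilcoxeter \<Rightarrow> ('a, 'b) nilcoxeter" is "(-)"
proof -
  fix a b c d :: "'a gen_word \<Rightarrow>\<^sub>0 'b"
  assume "nc_rel a b" "nc_rel c d"
  then have "(a - b) + - (c - d) \<in> two_sided_ideal nc_relators"
    unfolding nc_rel_def by (intro two_sided_ideal_plus two_sided_ideal_uminus)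
  then show "nc_rel (a - c) (b - d)" by (simp add: nc_rel_def algebra_simps)
qed

lift_definition times_nilcoxeter ::
  "('a, 'b) nilcoxeter \<Rightarrow> ('a, 'b) nilcoxeter \<Rightarrow> ('a, 'b) nilcoxeter" is "(*)"
proof -
  fix a b c d :: "'a gen_word \<Rightarrow>\<^sub>0 'b"
  assume "nc_rel a b" "nc_rel c d"
  then have "(a - b) * c + b * (c - d) \<in> two_sided_ideal nc_relators"
    unfolding nc_rel_def
    by (intro two_sided_ideal_plus two_sided_ideal_left two_sided_ideal_right)
  then show "nc_rel (a * c) (b * d)" by (simp add: nc_rel_def algebra_simps)
qed

lift_definition one_nilcoxeter :: "('a, 'b) nilcoxeter" is 1 .

instance
proof
  have "\<not> nc_rel 0 (1 :: 'a gen_word \<Rightarrow>\<^sub>0 'b)"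
    using const_coeff_ideal[of "- 1 :: 'a gen_word \<Rightarrow>\<^sub>0 'b"]
    by (auto simp: nc_rel_def lookup_one)
  then show "(0 :: ('a, 'b) nilcoxeter) \<noteq> 1" by transfer
qed (transfer; simp add: algebra_simps nc_rel_def two_sided_ideal.zero)+

end

lift_definition nc_scale :: "'k::field \<Rightarrow> ('n::finite, 'k) nilcoxeter \<Rightarrow> ('n, 'k) nilcoxeter"
  is free_scale
  unfolding nc_rel_def free_scale_def
  by (metis right_diff_distrib two_sided_ideal_left)

global_interpretation nc: vector_space "nc_scale :: 'k::field \<Rightarrow> ('n::finite, 'k) nilcoxeter \<Rightarrow> _"
proof unfold_locales
  fix a b :: 'k and x y :: "('n, 'k) nilcoxeter"
  show "nc_scale a (x + y) = nc_scale a x + nc_scale a y"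
    by transfer (simp add: nc_rel_def free_scale_def distrib_left two_sided_ideal.zero)
  show "nc_scale (a + b) x = nc_scale a x + nc_scale b x"
    by transfer
      (simp add: nc_rel_def free_scale_def distrib_right single_add two_sided_ideal.zero)
  show "nc_scale a (nc_scale b x) = nc_scale (a * b) x"
    by transfer (simp add: nc_rel_def free_scale_def mult_single two_sided_ideal.zero
        flip: mult.assoc)
  show "nc_scale 1 x = x"
    by transfer (simp add: nc_rel_def free_scale_def two_sided_ideal.zero)
qed

lemma scalar_central:
  fixes p :: "'n::finite gen_word \<Rightarrow>\<^sub>0 'k::field"
  shows "Poly_Mapping.single 0 c * p = p * Poly_Mapping.single 0 c"
  by (induction p rule: gen_word_poly_induct) (auto simp: algebra_simps mult_single)

lemma nc_scale_mult_left: "nc_scale c x * y = nc_scale c (x * y)"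
  by transfer (simp add: nc_rel_def free_scale_def mult.assoc two_sided_ideal.zero)

lemma nc_scale_mult_right: "x * nc_scale c y = nc_scale c (x * y)"
proof transfer
  fix x y :: "'a gen_word \<Rightarrow>\<^sub>0 'b" and c
  have "x * free_scale c y = free_scale c (x * y)"
    unfolding free_scale_def by (metis mult.assoc scalar_central)
  then show "nc_rel (x * free_scale c y) (free_scale c (x * y))"
    by (simp add: nc_rel_def two_sided_ideal.zero)
qed

lift_definition nc_T :: "nat \<Rightarrow> ('n::finite, 'k::field) nilcoxeter" is free_gen .

lift_definition flip_word :: "'n::finite gen_word \<Rightarrow> 'n gen_word" is "map (\<lambda>i. CARD('n) - i)"
  by (fastforce simp: subset_iff)

text \<open>
  \<open>map_key\<close> precomposes with \<open>flip_word\<close>; as \<open>flip_word\<close> is an involution, this is the linear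
  extension of \<open>flip_word\<close>.
\<close>

definition free_flip :: "('n::finite gen_word \<Rightarrow>\<^sub>0 'k::field) \<Rightarrow> ('n gen_word \<Rightarrow>\<^sub>0 'k)"
  where "free_flip = Poly_Mapping.map_key flip_word"

lemma flip_word_flip_word [simp]: "flip_word (flip_word w) = w"
  by transfer (auto intro!: map_idI)

lemma inj_flip_word: "inj flip_word"
  by (metis flip_word_flip_word injI)

lemma flip_word_0 [simp]: "flip_word 0 = 0"
  by transfer simp

lemma flip_word_add: "flip_word (u + v) = flip_word u + flip_word v"
  by transfer simp

lemma flip_word_letter:
  "i \<in> {1..<CARD('n)} \<Longrightarrow> flip_word (letter i :: 'n::finite gen_word) = letter (CARD('n) - i)"
  by transfer auto

lemma free_flip_single: "free_flip (Poly_Mapping.single w c) = Poly_Mapping.single (flip_word w) c"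
  unfolding free_flip_def by (metis flip_word_flip_word inj_flip_word map_key_single)

lemma free_flip_0 [simp]: "free_flip 0 = 0"
  by (simp add: free_flip_def inj_flip_word map_key_zero)

lemma free_flip_add: "free_flip (p + q) = free_flip p + free_flip q"
  by (simp add: free_flip_def inj_flip_word map_key_plus)

lemma free_flip_diff: "free_flip (p - q) = free_flip p - free_flip q"
  by (metis add_diff_cancel diff_add_cancel free_flip_add)

lemma free_flip_mult: "free_flip (p * q) = free_flip p * free_flip q"
proof (induction p rule: gen_word_poly_induct)
  case (single w c)
  show ?case
    by (induction q rule: gen_word_poly_induct)
      (auto simp: mult_single free_flip_single flip_word_add distrib_left free_flip_add)
qed (auto simp: distrib_right free_flip_add)

lemma free_flip_gen:
  "i \<in> {1..<CARD('n)} \<Longrightarrow>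
    free_flip (free_gen i :: 'n::finite gen_word \<Rightarrow>\<^sub>0 'k::field) = free_gen (CARD('n) - i)"
  by (simp add: free_gen_def free_flip_single flip_word_letter)

lemma free_flip_relator:
  fixes r :: "'n::finite gen_word \<Rightarrow>\<^sub>0 'k::field"
  assumes "r \<in> nc_relators"
  shows "free_flip r \<in> two_sided_ideal nc_relators"
proof -
  let ?g = "free_gen :: nat \<Rightarrow> 'n gen_word \<Rightarrow>\<^sub>0 'k" and ?n = "CARD('n)"
  consider
    (braid) i where "1 \<le> i" "i + 1 < ?n"
      "r = ?g i * ?g (i + 1) * ?g i - ?g (i + 1) * ?g i * ?g (i + 1)"
  | (comm) i j where "i \<in> {1..<?n}" "j \<in> {1..<?n}" "\<bar>int i - int j\<bar> > 1"
      "r = ?g i * ?g j - ?g j * ?g i"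
  | (nil) i where "i \<in> {1..<?n}" "r = ?g i * ?g i"
    using assms unfolding nc_relators_def by blast
  then show ?thesis
  proof cases
    case braid
    define j where "j = ?n - (i + 1)"
    have j: "1 \<le> j" "j + 1 < ?n" "?n - i = j + 1" using braid by (auto simp: j_def)
    have "free_flip r = - (?g j * ?g (j + 1) * ?g j - ?g (j + 1) * ?g j * ?g (j + 1))"
      using braid j by (simp add: free_flip_diff free_flip_mult free_flip_gen j_def)
    moreover have "?g j * ?g (j + 1) * ?g j - ?g (j + 1) * ?g j * ?g (j + 1) \<in> nc_relators"
      unfolding nc_relators_def using j by blast
    ultimately show ?thesis by (metis two_sided_ideal_base two_sided_ideal_uminus)
  next
    case comm
    define i' j' where "i' = ?n - i" and "j' = ?n - j"
    have ij: "i' \<in> {1..<?n}" "j' \<in> {1..<?n}" "\<bar>int i' - int j'\<bar> > 1"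
      using comm by (auto simp: i'_def j'_def)
    have "free_flip r = ?g i' * ?g j' - ?g j' * ?g i'"
      using comm by (simp add: free_flip_diff free_flip_mult free_flip_gen i'_def j'_def)
    then have "free_flip r \<in> nc_relators"
      unfolding nc_relators_def using ij by blast
    then show ?thesis by (rule two_sided_ideal_base)
  next
    case nil
    define i' where "i' = ?n - i"
    have i': "i' \<in> {1..<?n}" using nil by (auto simp: i'_def)
    have "free_flip r = ?g i' * ?g i'"
      using nil by (simp add: free_flip_mult free_flip_gen i'_def)
    then have "free_flip r \<in> nc_relators"
      unfolding nc_relators_def using i' by blast
    then show ?thesis by (rule two_sided_ideal_base)
  qed
qed

lemma free_flip_ideal:
  assumes "x \<in> two_sided_ideal nc_relators"
  shows "free_flip x \<in> two_sided_ideal nc_relators"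
  using assms
  by (induction rule: two_sided_ideal.induct)
    (auto simp: free_flip_add free_flip_mult two_sided_ideal.zero
      intro!: two_sided_ideal_plus two_sided_ideal_mult free_flip_relator)

lift_definition nc_flip :: "('n::finite, 'k::field) nilcoxeter \<Rightarrow> ('n, 'k) nilcoxeter" is free_flip
  unfolding nc_rel_def by (metis free_flip_diff free_flip_ideal)

lemma nc_flip_T:
  "i \<in> {1..<CARD('n)} \<Longrightarrow> nc_flip (nc_T i :: ('n::finite, 'k::field) nilcoxeter) = nc_T (CARD('n) - i)"
  by transfer (simp add: free_flip_gen nc_rel_def two_sided_ideal.zero)

lemma nc_flip_mult: "nc_flip (x * y) = nc_flip x * nc_flip y"
  by transfer (simp add: free_flip_mult nc_rel_def two_sided_ideal.zero)

lemma nc_flip_add: "nc_flip (x + y) = nc_flip x + nc_flip y"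
  by transfer (simp add: free_flip_add nc_rel_def two_sided_ideal.zero)

lemma nc_flip_one: "nc_flip 1 = 1"
  by transfer (metis flip_word_0 free_flip_single equivp_nc_rel equivp_reflp single_one)

lemma nc_flip_scale: "nc_flip (nc_scale c x) = nc_scale c (nc_flip x)"
  by transfer (simp add: free_flip_mult free_flip_single free_scale_def nc_rel_def
      two_sided_ideal.zero)

lemma nc_flip_flip: "nc_flip (nc_flip x) = x"
proof transfer
  fix x :: "'a gen_word \<Rightarrow>\<^sub>0 'b"
  have "free_flip (free_flip x) = x"
    by (induction x rule: gen_word_poly_induct) (auto simp: free_flip_single free_flip_add)
  then show "nc_rel (free_flip (free_flip x)) x"
    by (simp add: nc_rel_def two_sided_ideal.zero)
qed

text \<open>
  The elements of the quotient of the algebra by the twisted commutator subspace are represented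
  as cosets; \<open>nc_proj 0\<close> is the zero of the quotient.
\<close>

definition twisted_commutators :: "('n::finite, 'k::field) nilcoxeter set"
  where "twisted_commutators = nc.span {a * b - b * nc_flip a | a b. True}"

definition nc_proj :: "('n::finite, 'k::field) nilcoxeter \<Rightarrow> ('n, 'k) nilcoxeter set"
  where "nc_proj a = a +o twisted_commutators"

definition nc_center :: "('n::finite, 'k::field) nilcoxeter set"
  where "nc_center = {z. \<forall>a. z * a = a * z}"

definition word_perm :: "nat list \<Rightarrow> nat \<Rightarrow> nat"
  where "word_perm ws = foldr (\<lambda>i w. Transposition.transpose i (i + 1) \<circ> w) ws id"

definition expression_of :: "nat \<Rightarrow> (nat \<Rightarrow> nat) \<Rightarrow> nat list \<Rightarrow> bool"
  where "expression_of n w ws \<longleftrightarrow> set ws \<subseteq> {1..<n} \<and> word_perm ws = w"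

definition reduced_expression :: "nat \<Rightarrow> (nat \<Rightarrow> nat) \<Rightarrow> nat list \<Rightarrow> bool"
  where "reduced_expression n w = is_arg_min length (expression_of n w)"

definition perm_length :: "nat \<Rightarrow> (nat \<Rightarrow> nat) \<Rightarrow> nat"
  where "perm_length n w = (LEAST l. \<exists>ws. expression_of n w ws \<and> length ws = l)"

definition longest_perm :: "nat \<Rightarrow> nat \<Rightarrow> nat"
  where "longest_perm n = arg_max (perm_length n) (\<lambda>w. w permutes {1..n})"

text \<open>By Matsumoto's theorem \<open>nc_Tw\<close> does not depend on the chosen reduced expression.\<close>

definition nc_Tw :: "(nat \<Rightarrow> nat) \<Rightarrow> ('n::finite, 'k::field) nilcoxeter"
  where "nc_Tw w = prod_list (map nc_T (SOME ws. reduced_expression CARD('n) w ws))"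

definition nc_classes :: "('n::finite, 'k::field) nilcoxeter set set"
  where "nc_classes =
    {nc_proj (nc_Tw w) | w. w permutes {1..CARD('n)} \<and>
      nc_proj (nc_Tw w :: ('n, 'k) nilcoxeter) \<noteq> nc_proj 0}"

definition nc_z :: "('n::finite, 'k::field) nilcoxeter set \<Rightarrow> ('n, 'k) nilcoxeter"
  where "nc_z c =
    (\<Sum>w | w permutes {1..CARD('n)} \<and> nc_proj (nc_Tw w :: ('n, 'k) nilcoxeter) = c.
      nc_Tw (inv w \<circ> longest_perm CARD('n)))"

end

theory Submission
  imports Defs
begin

text \<open>
  The coefficient \<open>\<lambda>\<close> of \<open>T\<^sub>w\<close> at the longest element \<open>w\<^sub>0\<close> is a nondegenerate twisted trace,
  \<open>\<lambda>(a b) = \<lambda>(b f(a))\<close>, so \<open>z\<close> is central iff \<open>a \<mapsto> \<lambda>(a z)\<close> kills the twisted commutators; the \<open>z\<^sub>c\<close>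
  are dual to the classes \<open>c\<close>, hence a basis of the center.

  For the products, let \<open>F\<close> be the support of a central element. Comparing coefficients in
  \<open>T\<^sub>u z = z T\<^sub>u\<close> shows that \<open>F\<close> is stable: if \<open>w \<in> F\<close> and \<open>u w\<close> is length-additive, then
  \<open>u w u\<^sup>-\<^sup>1 \<in> F\<close> and \<open>(u w u\<^sup>-\<^sup>1) u\<close> is length-additive, and symmetrically. It remains to see that \<open>u x\<close> is
  never length-additive for non-identity elements \<open>u\<close>, \<open>x\<close> of stable sets. If it were, the inversion
  sets of \<open>u\<close> and \<open>x\<^sup>-\<^sup>1\<close> would be disjoint. A right-to-left minimum \<open>a\<close> of \<open>u\<close> then yields the
  right-to-left minimum \<open>u\<^sup>-\<^sup>1(a)\<close> of \<open>x\<^sup>-\<^sup>1\<close>, this correspondence is order-reversing, and composing it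
  with the one for \<open>x\<^sup>-\<^sup>1\<close> gives a strictly monotone self-map of a finite set, which is the identity. So \<open>u\<close> and \<open>x\<close>
  agree at \<open>n\<close>, and, since \<open>u x = x (x\<^sup>-\<^sup>1 u x)\<close> is of the same form, on the whole orbit of \<open>n\<close> under \<open>x\<close>.
  On this orbit \<open>x\<close> and \<open>x\<^sup>-\<^sup>1\<close> have no common inversion, which forces a 4-cycle
  \<open>m \<mapsto> q \<mapsto> n \<mapsto> l \<mapsto> m\<close>, and conjugating by simple transpositions rules this out.
\<close>

subsection \<open>Inversions and length-additive products\<close>

definition inversions :: "nat \<Rightarrow> (nat \<Rightarrow> nat) \<Rightarrow> (nat \<times> nat) set" where
  "inversions n w = {(a, b). a \<in> {1..n} \<and> b \<in> {1..n} \<and> a < b \<and> w b < w a}"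

definition ninv :: "nat \<Rightarrow> (nat \<Rightarrow> nat) \<Rightarrow> nat" where
  "ninv n w = card (inversions n w)"

text \<open>The inversions of \<open>w\<close> that composing with \<open>u\<close> on the left puts
  back in order; they measure how far lengths fail to add.\<close>

definition undone :: "nat \<Rightarrow> (nat \<Rightarrow> nat) \<Rightarrow> (nat \<Rightarrow> nat) \<Rightarrow> (nat \<times> nat) set" where
  "undone n u w = {(a, b) \<in> inversions n w. u (w a) < u (w b)}"

text \<open>Additivity of lengths in pairwise form: \<open>u\<close> restores no inversion of
  \<open>w\<close>. The numerical form is \<open>length_additive_iff_ninv\<close>.\<close>

definition length_additive :: "nat \<Rightarrow> (nat \<Rightarrow> nat) \<Rightarrow> (nat \<Rightarrow> nat) \<Rightarrow> bool" where
  "length_additive n u w \<longleftrightarrow> (\<forall>a\<in>{1..n}. \<forall>b\<in>{1..n}. a < b \<longrightarrow> w b < w a \<longrightarrow> u (w b) < u (w a))"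

lemma finite_inversions [simp]: "finite (inversions n w)"
  by (rule finite_subset[of _ "{1..n} \<times> {1..n}"]) (auto simp: inversions_def)

lemma permutes_less_or_greater:
  assumes "w permutes (S :: nat set)" "a \<noteq> b"
  shows "w a < w b \<or> w b < w a"
  using assms by (metis permutes_inj injD nat_neq_iff)

text \<open>Inversions of \<open>w\<close> split into the undone ones and a surviving set
  \<open>L\<close>, those of \<open>u \<circ> w\<close> into \<open>L\<close> and a set
  \<open>K\<close> of pairs that only \<open>u\<close> inverts. Transport along \<open>w\<close>
  matches \<open>K\<close> together with the undone pairs to the inversions of \<open>u\<close>, so
  an undone pair counts twice on the right.\<close>

lemma ninv_comp:
  assumes u: "u permutes {1..n}" and w: "w permutes {1..n}"
  shows "ninv n (u \<circ> w) + 2 * card (undone n u w) = ninv n u + ninv n w"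
proof -
  define K where "K = {(a, b). a \<in> {1..n} \<and> b \<in> {1..n} \<and> a < b \<and> w a < w b \<and> u (w b) < u (w a)}"
  define L where "L = {(a, b) \<in> inversions n w. u (w b) < u (w a)}"
  have fin: "finite K" "finite L" "finite (undone n u w)"
    by (auto intro: finite_subset[of _ "{1..n} \<times> {1..n}"] simp: K_def L_def inversions_def undone_def)
  have 1: "inversions n w = undone n u w \<union> L" "undone n u w \<inter> L = {}"
  proof -
    have "p \<in> inversions n w \<longleftrightarrow> p \<in> undone n u w \<or> p \<in> L" for p
      using permutes_less_or_greater[OF u, of "w (fst p)" "w (snd p)"]
      by (cases p) (auto simp: undone_def L_def inversions_def)
    then show "inversions n w = undone n u w \<union> L" by blast
  qed (auto simp: undone_def L_def)
  have 2: "inversions n (u \<circ> w) = K \<union> L" "K \<inter> L = {}"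
  proof -
    have "p \<in> inversions n (u \<circ> w) \<longleftrightarrow> p \<in> K \<or> p \<in> L" for p
      using permutes_less_or_greater[OF w, of "fst p" "snd p"]
      by (cases p) (auto simp: K_def L_def inversions_def)
    then show "inversions n (u \<circ> w) = K \<union> L" by blast
  qed (auto simp: K_def L_def inversions_def)
  have 3: "K \<inter> undone n u w = {}" by (auto simp: K_def undone_def inversions_def)
  \<comment> \<open>\<open>f v\<close> carries a pair along \<open>v\<close> and then sorts it,
    because \<open>w\<close> reverses the undone pairs but keeps the pairs of \<open>K\<close> in
    order.\<close>
  define f where "f = (\<lambda>v :: nat \<Rightarrow> nat. \<lambda>(a, b). if v a < v b then (v a, v b) else (v b, v a))"
  note inv = permutes_inverses[OF w] and iw = permutes_in_image[OF w]
    and iw' = permutes_in_image[OF permutes_inv[OF w]]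
  have iw2: "w x \<in> {1..n}" "inv w x \<in> {1..n}" if "x \<in> {1..n}" for x
    using that iw iw' by blast+
  have "bij_betw (f w) (K \<union> undone n u w) (inversions n u)"
  proof (rule bij_betw_byWitness[where f' = "f (inv w)"])
    show "\<forall>p\<in>K \<union> undone n u w. f (inv w) (f w p) = p"
      by (auto simp: f_def K_def undone_def inversions_def inv)
    show "\<forall>p\<in>inversions n u. f w (f (inv w) p) = p"
    proof
      fix p assume "p \<in> inversions n u"
      then obtain x y where "p = (x, y)" "x < y" by (auto simp: inversions_def)
      then show "f w (f (inv w) p) = p" by (simp add: f_def inv)
    qed
    show "f w ` (K \<union> undone n u w) \<subseteq> inversions n u"
    proof
      fix q assume "q \<in> f w ` (K \<union> undone n u w)"
      then obtain a b where q: "q = f w (a, b)" "(a, b) \<in> K \<union> undone n u w" by auto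
      then have "a \<in> {1..n}" "b \<in> {1..n}"
        by (auto simp: K_def undone_def inversions_def)
      then have "w a \<in> {1..n}" "w b \<in> {1..n}" using iw2(1) by blast+
      then show "q \<in> inversions n u"
        using q by (auto simp: f_def K_def undone_def inversions_def)
    qed
    show "f (inv w) ` inversions n u \<subseteq> K \<union> undone n u w"
    proof
      fix q assume "q \<in> f (inv w) ` inversions n u"
      then obtain x y where q: "q = f (inv w) (x, y)" "x < y" "u y < u x"
        and xy: "x \<in> {1..n}" "y \<in> {1..n}"
        by (auto simp: inversions_def)
      have "inv w x \<in> {1..n}" "inv w y \<in> {1..n}" using xy iw2(2) by blast+
      moreover have "inv w x < inv w y \<or> inv w y < inv w x"
        using permutes_less_or_greater[OF permutes_inv[OF w]] q(2) by simp
      ultimately show "q \<in> K \<union> undone n u w"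
        using q by (auto simp: f_def K_def undone_def inversions_def inv)
    qed
  qed
  then have "ninv n u = card K + card (undone n u w)"
    unfolding ninv_def by (metis bij_betw_same_card card_Un_disjoint fin(1,3) 3)
  moreover have "ninv n w = card (undone n u w) + card L" "ninv n (u \<circ> w) = card K + card L"
    unfolding ninv_def 1(1) 2(1) using fin 1(2) 2(2) by (auto intro: card_Un_disjoint)
  ultimately show ?thesis by simp
qed

lemma length_additive_iff_undone:
  assumes "u permutes {1..n}"
  shows "length_additive n u w \<longleftrightarrow> undone n u w = {}"
proof
  assume "length_additive n u w"
  then show "undone n u w = {}"
    by (fastforce simp: length_additive_def undone_def inversions_def)
next
  assume *: "undone n u w = {}"
  show "length_additive n u w" unfolding length_additive_def
  proof (intro ballI impI)
    fix a b assume "a \<in> {1..n}" "b \<in> {1..n}" "a < b" "w b < w a"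
    then show "u (w b) < u (w a)"
      using permutes_less_or_greater[OF assms, of "w a" "w b"] *
      by (auto simp: undone_def inversions_def)
  qed
qed

lemma finite_undone [simp]: "finite (undone n u w)"
  unfolding undone_def by (rule finite_subset[of _ "inversions n w"]) auto

lemma length_additive_iff_ninv:
  assumes "u permutes {1..n}" "w permutes {1..n}"
  shows "length_additive n u w \<longleftrightarrow> ninv n (u \<circ> w) = ninv n u + ninv n w"
  using ninv_comp[OF assms] length_additive_iff_undone[OF assms(1), of w]
    card_0_eq[OF finite_undone, of n u w] by linarith

lemma ninv_comp_le:
  assumes "u permutes {1..n}" "w permutes {1..n}"
  shows "ninv n (u \<circ> w) \<le> ninv n u + ninv n w"
  using ninv_comp[OF assms] by simp

text \<open>If values \<open>a < b\<close> of \<open>u \<circ> w\<close> sat at positions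
  \<open>x < y\<close> although \<open>inv u b < inv u a\<close>, then \<open>(x, y)\<close> would
  be an inversion of \<open>w\<close> that \<open>u\<close> undoes.\<close>

lemma length_additive_inv:
  assumes u: "u permutes {1..n}" and w: "w permutes {1..n}" and "length_additive n u w"
  shows "length_additive n (inv w) (inv u)"
  unfolding length_additive_def
proof (intro ballI impI)
  fix a b assume ab: "a \<in> {1..n}" "b \<in> {1..n}" "a < b" "inv u b < inv u a"
  note pu = permutes_inverses[OF u] and pw = permutes_inverses[OF w]
  define x y where "x = inv w (inv u a)" and "y = inv w (inv u b)"
  have xy: "x \<in> {1..n}" "y \<in> {1..n}" "u (w x) = a" "u (w y) = b" "w x = inv u a" "w y = inv u b"
    using ab(1,2) permutes_in_image[OF permutes_inv[OF u]] permutes_in_image[OF permutes_inv[OF w]]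
    by (auto simp: x_def y_def pu pw)
  have "\<not> x < y" using assms(3) xy ab unfolding length_additive_def by fastforce
  moreover have "x \<noteq> y" using xy ab by auto
  ultimately show "inv w (inv u b) < inv w (inv u a)" by (simp add: x_def y_def)
qed

section \<open>Left multiplication by simple transpositions\<close>

abbreviation adj :: "nat \<Rightarrow> nat \<Rightarrow> nat" where
  "adj i \<equiv> Transposition.transpose i (Suc i)"

lemma adj_permutes: "i \<in> {1..<n} \<Longrightarrow> adj i permutes {1..n}"
  by (intro permutes_swap_id) auto

lemma inversions_adj:
  assumes "i \<in> {1..<n}" shows "inversions n (adj i) = {(i, i + 1)}"
  using assms by (auto simp: inversions_def transpose_def split: if_splits)

lemma ninv_adj: "i \<in> {1..<n} \<Longrightarrow> ninv n (adj i) = 1"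
  using inversions_adj by (simp add: ninv_def)

lemma adj_reverses: "y < x \<Longrightarrow> adj i x < adj i y \<Longrightarrow> x = i + 1 \<and> y = i"
  by (auto simp: transpose_def split: if_splits)

lemma undone_adj:
  assumes "i \<in> {1..<n}" "w permutes {1..n}"
  shows "undone n (adj i) w = {} \<longleftrightarrow> inv w i < inv w (i + 1)"
proof -
  note pw = permutes_inverses[OF assms(2)]
  have im: "inv w i \<in> {1..n}" "inv w (i+1) \<in> {1..n}"
    using assms permutes_in_image[OF permutes_inv[OF assms(2)]] by auto
  show ?thesis
  proof
    assume *: "undone n (adj i) w = {}"
    have "(inv w (i+1), inv w i) \<notin> undone n (adj i) w" using * by simp
    then have "\<not> inv w (i+1) < inv w i"
      using im by (auto simp: undone_def inversions_def pw transpose_def)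
    moreover have "inv w i \<noteq> inv w (i+1)" by (metis pw(1) add.right_neutral add_left_cancel one_neq_zero)
    ultimately show "inv w i < inv w (i + 1)" by simp
  next
    assume *: "inv w i < inv w (i + 1)"
    have "(a, b) \<notin> undone n (adj i) w" for a b
      using adj_reverses[of "w b" "w a" i] * pw(2)[of a] pw(2)[of b]
      by (auto simp: undone_def inversions_def)
    then show "undone n (adj i) w = {}" by auto
  qed
qed

text \<open>Only the values \<open>i\<close> and \<open>i + 1\<close> change order under
  \<open>adj i\<close>, so at most one inversion of \<open>w\<close> is undone and the length moves
  by exactly one.\<close>

lemma ninv_adj_comp:
  assumes "i \<in> {1..<n}" "w permutes {1..n}"
  shows "inv w i < inv w (i + 1) \<Longrightarrow> ninv n (adj i \<circ> w) = ninv n w + 1"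
    and "inv w (i + 1) < inv w i \<Longrightarrow> ninv n (adj i \<circ> w) + 1 = ninv n w"
proof -
  have *: "ninv n (adj i \<circ> w) + 2 * card (undone n (adj i) w) = 1 + ninv n w"
    using ninv_comp[OF adj_permutes[OF assms(1)] assms(2)] ninv_adj[OF assms(1)] by simp
  have e: "card (undone n (adj i) w) = 0 \<longleftrightarrow> inv w i < inv w (i + 1)"
    using undone_adj[OF assms] by simp
  show "inv w i < inv w (i + 1) \<Longrightarrow> ninv n (adj i \<circ> w) = ninv n w + 1"
    using * e by simp
  assume "inv w (i + 1) < inv w i"
  then have 1: "card (undone n (adj i) w) \<ge> 1" using e by linarith
  have "undone n (adj i) w \<subseteq> {(inv w (i+1), inv w i)}"
  proof (intro subsetI)
    fix p assume "p \<in> undone n (adj i) w"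
    then obtain a b where "p = (a, b)" "w b < w a" "adj i (w a) < adj i (w b)"
      by (auto simp: undone_def inversions_def)
    then show "p \<in> {(inv w (i + 1), inv w i)}"
      using adj_reverses[of "w b" "w a" i] permutes_inverses(2)[OF assms(2), of a]
        permutes_inverses(2)[OF assms(2), of b] by simp
  qed
  then have "card (undone n (adj i) w) \<le> 1"
    using card_mono[of "{(inv w (i+1), inv w i)}"] by simp
  then show "ninv n (adj i \<circ> w) + 1 = ninv n w"
    using * 1 by linarith
qed

lemma adj_adj [simp]: "adj i \<circ> (adj i \<circ> w) = w"
  by (simp add: fun_eq_iff)

lemma inv_adj_comp:
  assumes "w permutes S"
  shows "inv (adj i \<circ> w) x = inv w (adj i x)"
  by (simp add: o_inv_distrib[OF _ permutes_bij[OF assms]])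

subsection \<open>Stable sets of permutations\<close>

text \<open>Modelled on the support of a central \<open>z\<close>: the two halves compare the
  coefficients at \<open>u \<circ> w\<close> and at \<open>w \<circ> u\<close> on both sides of the
  commutation with \<open>nc_Tw u\<close>. The additivity claims say that the matching product on
  the other side does not vanish.\<close>

definition stable :: "nat \<Rightarrow> (nat \<Rightarrow> nat) set \<Rightarrow> bool" where
  "stable n F \<longleftrightarrow> (\<forall>w\<in>F. w permutes {1..n} \<and> (\<forall>u. u permutes {1..n} \<longrightarrow>
     (length_additive n u w \<longrightarrow> u \<circ> w \<circ> inv u \<in> F \<and> length_additive n (u \<circ> w \<circ> inv u) u) \<and>
     (length_additive n w u \<longrightarrow> inv u \<circ> w \<circ> u \<in> F \<and> length_additive n u (inv u \<circ> w \<circ> u))))"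

lemma stableD:
  assumes "stable n F" "w \<in> F"
  shows "w permutes {1..n}"
    and "u permutes {1..n} \<Longrightarrow> length_additive n u w \<Longrightarrow> u \<circ> w \<circ> inv u \<in> F"
    and "u permutes {1..n} \<Longrightarrow> length_additive n u w \<Longrightarrow> length_additive n (u \<circ> w \<circ> inv u) u"
    and "u permutes {1..n} \<Longrightarrow> length_additive n w u \<Longrightarrow> inv u \<circ> w \<circ> u \<in> F"
    and "u permutes {1..n} \<Longrightarrow> length_additive n w u \<Longrightarrow> length_additive n u (inv u \<circ> w \<circ> u)"
  using assms unfolding stable_def by blast+

lemma inv_conj:
  assumes "u permutes S" "w permutes S"
  shows "inv (u \<circ> w \<circ> inv u) = u \<circ> inv w \<circ> inv u" "inv (inv u \<circ> w \<circ> u) = inv u \<circ> inv w \<circ> u"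
proof -
  note b = permutes_bij[OF assms(1)] permutes_bij[OF assms(2)] permutes_bij[OF permutes_inv[OF assms(1)]]
  show "inv (u \<circ> w \<circ> inv u) = u \<circ> inv w \<circ> inv u" "inv (inv u \<circ> w \<circ> u) = inv u \<circ> inv w \<circ> u"
    using b by (simp_all add: o_inv_distrib bij_comp permutes_inv_inv[OF assms(1)] o_assoc)
qed

text \<open>By \<open>length_additive_inv\<close>, inversion exchanges the two halves of
  stability.\<close>

lemma stable_inv:
  assumes "stable n F"
  shows "stable n (inv ` F)"
  unfolding stable_def
proof (intro ballI conjI allI impI)
  fix w' assume "w' \<in> inv ` F"
  then obtain w where w: "w \<in> F" "w' = inv w" by auto
  note pw = stableD(1)[OF assms w(1)]
  show pw': "w' permutes {1..n}" using pw w(2) permutes_inv by auto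
  fix u assume u: "u permutes {1..n}"
  note pu = permutes_inv[OF u]
  note S = stableD[OF assms w(1)]
  have c: "u \<circ> w \<circ> inv u permutes {1..n}" "inv u \<circ> w \<circ> u permutes {1..n}"
    using u pu pw by (simp_all add: permutes_compose)
  have ii: "inv (inv u) = u" "inv (inv w) = w" using u pw by (simp_all add: permutes_inv_inv)
  note ic = inv_conj[OF u pw]
  {
    assume "length_additive n u w'"
    then have "length_additive n w (inv u)"
      using length_additive_inv[OF u pw'] w(2) ii by simp
    from S(4)[OF pu this] S(5)[OF pu this]
    have 1: "u \<circ> w \<circ> inv u \<in> F" "length_additive n (inv u) (u \<circ> w \<circ> inv u)" by (simp_all add: ii)
    show "u \<circ> w' \<circ> inv u \<in> inv ` F"
      unfolding w(2) ic(1)[symmetric] using 1(1) by (rule imageI)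
    show "length_additive n (u \<circ> w' \<circ> inv u) u"
      using length_additive_inv[OF pu c(1) 1(2)] by (simp add: ii w(2) ic)
  }
  {
    assume "length_additive n w' u"
    then have "length_additive n (inv u) w"
      using length_additive_inv[OF pw' u] w(2) ii by simp
    from S(2)[OF pu this] S(3)[OF pu this]
    have 1: "inv u \<circ> w \<circ> u \<in> F" "length_additive n (inv u \<circ> w \<circ> u) (inv u)" by (simp_all add: ii)
    show "inv u \<circ> w' \<circ> u \<in> inv ` F"
      unfolding w(2) ic(2)[symmetric] using 1(1) by (rule imageI)
    show "length_additive n u (inv u \<circ> w' \<circ> u)"
      using length_additive_inv[OF c(2) pu 1(2)] by (simp add: ii w(2) ic)
  }
qed

section \<open>Double ascents in stable sets\<close>

text \<open>\<open>u\<close> replaces each key by its rank. This lets stability be applied to a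
  permutation given only by the order that it imposes.\<close>

lemma sorting_permutation:
  fixes K :: "nat \<Rightarrow> nat"
  assumes "inj_on K {1..n}"
  obtains u where "u permutes {1..n}"
    and "\<And>a b. a \<in> {1..n} \<Longrightarrow> b \<in> {1..n} \<Longrightarrow> u a < u b \<longleftrightarrow> K a < K b"
proof -
  define u where "u v = (if v \<in> {1..n} then card {x \<in> {1..n}. K x \<le> K v} else v)" for v
  have mono: "u a < u b" if "a \<in> {1..n}" "b \<in> {1..n}" "K a < K b" for a b
  proof -
    have "{x \<in> {1..n}. K x \<le> K a} \<subset> {x \<in> {1..n}. K x \<le> K b}"
    proof (rule psubsetI)
      have "b \<in> {x \<in> {1..n}. K x \<le> K b}" "b \<notin> {x \<in> {1..n}. K x \<le> K a}" using that by auto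
      then show "{x \<in> {1..n}. K x \<le> K a} \<noteq> {x \<in> {1..n}. K x \<le> K b}" by blast
    qed (use that in auto)
    then have "card {x \<in> {1..n}. K x \<le> K a} < card {x \<in> {1..n}. K x \<le> K b}"
      by (intro psubset_card_mono) auto
    then show ?thesis using that by (simp add: u_def)
  qed
  have iff: "u a < u b \<longleftrightarrow> K a < K b" if "a \<in> {1..n}" "b \<in> {1..n}" for a b
  proof (cases "a = b")
    case False
    then have "K a \<noteq> K b" using that inj_onD[OF assms] by blast
    then show ?thesis using mono[OF that] mono[OF that(2) that(1)] by linarith
  qed simp
  have inj: "inj_on u {1..n}"
  proof (rule inj_onI)
    fix a b assume ab: "a \<in> {1..n}" "b \<in> {1..n}" "u a = u b"
    then have "K a = K b" using iff[of a b] iff[of b a] by linarith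
    then show "a = b" using ab inj_onD[OF assms] by blast
  qed
  have "u v \<in> {1..n}" if "v \<in> {1..n}" for v
  proof -
    have "card {x \<in> {1..n}. K x \<le> K v} \<le> card {1..n}" by (intro card_mono) auto
    moreover have "card {x \<in> {1..n}. K x \<le> K v} > 0" using that by (auto simp: card_gt_0_iff)
    ultimately show ?thesis using that by (simp add: u_def)
  qed
  then have "u ` {1..n} = {1..n}"
    using inj by (intro endo_inj_surj) auto
  then have "bij_betw u {1..n} {1..n}" using inj unfolding bij_betw_def by blast
  then have "u permutes {1..n}"
    by (rule bij_imp_permutes) (unfold u_def, auto)
  then show ?thesis using iff that by blast
qed

text \<open>Stability is applied to the permutation \<open>u\<close> that moves \<open>w ` {1..t}\<close> to the end, preserving
  the order of these values and of the remaining ones.\<close>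

lemma double_ascent_inv:
  assumes F: "stable n F" and w: "w \<in> F" and ab: "a \<in> {1..n}" "b \<in> {1..n}" "a < b"
    and asc: "w a < w b" "inv w a < inv w b"
  shows "a \<le> inv w a \<and> inv w b \<le> b"
proof (rule ccontr)
  assume neg: "\<not> (a \<le> inv w a \<and> inv w b \<le> b)"
  note pw = stableD(1)[OF F w]
  note inv = permutes_inverses[OF pw]
  obtain t where t: "inv w a \<le> t" "t < inv w b" "a \<le> t \<longleftrightarrow> b \<le> t"
  proof (cases "inv w a < a")
    case True then show ?thesis using that[of "inv w a"] asc ab by auto
  next
    case False
    then have "b < inv w b" using neg by auto
    moreover have "inv w a \<le> inv w b - 1" using asc by linarith
    moreover have "a \<le> inv w b - 1 \<longleftrightarrow> b \<le> inv w b - 1" using calculation(1) ab(3) by linarith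
    ultimately show ?thesis using that[of "inv w b - 1"] by linarith
  qed
  \<comment> \<open>Adding \<open>n\<close> lifts the values at positions up to \<open>t\<close>
    above all others without changing their mutual order.\<close>
  define K where "K v = (if inv w v \<le> t then v + n else v)" for v
  have "inj_on K {1..n}" by (auto simp: inj_on_def K_def split: if_splits)
  then obtain u where u: "u permutes {1..n}"
    and uK: "\<And>x y. x \<in> {1..n} \<Longrightarrow> y \<in> {1..n} \<Longrightarrow> u x < u y \<longleftrightarrow> K x < K y"
    using sorting_permutation by blast
  have im: "w x \<in> {1..n}" if "x \<in> {1..n}" for x using that permutes_in_image[OF pw] by blast
  have "length_additive n u w"
    unfolding length_additive_def
  proof (intro ballI impI)
    fix c d assume cd: "c \<in> {1..n}" "d \<in> {1..n}" "c < d" "w d < w c"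
    then have "K (w d) < K (w c)" by (auto simp: K_def inv)
    then show "u (w d) < u (w c)" using uK im cd by blast
  qed
  then have add: "length_additive n (u \<circ> w \<circ> inv u) u" by (rule stableD(3)[OF F w u])
  \<comment> \<open>\<open>u\<close> reverses \<open>a\<close> and \<open>b\<close>, so additivity
    of the conjugate with \<open>u\<close> forces \<open>u\<close> to reverse \<open>w a\<close> and
    \<open>w b\<close> too, although both received the same shift.\<close>
  have "K b < K a" using t ab by (auto simp: K_def)
  then have "u b < u a" using uK ab by blast
  then have "u (w b) < u (w a)"
    using add ab unfolding length_additive_def by (fastforce simp: permutes_inverses[OF u])
  then have "K (w b) < K (w a)" using uK im ab by blast
  then show False using asc(1) t(3) by (auto simp: K_def inv split: if_splits)
qed

text \<open>The ascent conditions are symmetric in \<open>w\<close> and \<open>inv w\<close>, and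
  \<open>inv w\<close> lies in a stable set as well, so the bounds hold for both.\<close>

lemma double_ascent:
  assumes F: "stable n F" and w: "w \<in> F" and ab: "a \<in> {1..n}" "b \<in> {1..n}" "a < b"
    and asc: "w a < w b" "inv w a < inv w b"
  shows "a \<le> inv w a" "inv w b \<le> b" "a \<le> w a" "w b \<le> b"
proof -
  have "inv (inv w) = w" using stableD(1)[OF F w] by (rule permutes_inv_inv)
  then have "a \<le> w a \<and> w b \<le> b"
    using double_ascent_inv[OF stable_inv[OF F] imageI[OF w] ab] asc by simp
  then show "a \<le> inv w a" "inv w b \<le> b" "a \<le> w a" "w b \<le> b"
    using double_ascent_inv[OF assms] by auto
qed

text \<open>Were \<open>{k+1..n}\<close> invariant, so would be \<open>{1..k}\<close>, and every
  pair from the two blocks would be a double ascent. The resulting bounds on \<open>w\<close> and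
  \<open>inv w\<close> force \<open>w\<close> to fix every point.\<close>

lemma no_invariant_tail:
  assumes F: "stable n F" and w: "w \<in> F" "w \<noteq> id" and k: "1 \<le> k" "k < n"
  shows "\<exists>y\<in>{k+1..n}. w y \<le> k"
proof (rule ccontr)
  assume neg: "\<not> ?thesis"
  note pw = stableD(1)[OF F w(1)]
  note inv = permutes_inverses[OF pw]
  have im: "w x \<in> {1..n} \<longleftrightarrow> x \<in> {1..n}" "inv w x \<in> {1..n} \<longleftrightarrow> x \<in> {1..n}" for x
    using permutes_in_image[OF pw] permutes_in_image[OF permutes_inv[OF pw]] by auto
  have sub: "w ` {k+1..n} \<subseteq> {k+1..n}"
  proof
    fix x assume "x \<in> w ` {k+1..n}"
    then obtain y where y: "y \<in> {k+1..n}" "x = w y" by auto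
    then have "k < x" using neg by force
    then show "x \<in> {k+1..n}" using im(1)[of y] y k by auto
  qed
  have "inj_on w {k+1..n}" by (rule permutes_inj_on[OF pw])
  with sub have eq: "w ` {k+1..n} = {k+1..n}" by (intro endo_inj_surj) auto
  have hi: "w y \<in> {k+1..n}" "inv w y \<in> {k+1..n}" if "y \<in> {k+1..n}" for y
  proof -
    show "w y \<in> {k+1..n}" using imageI[OF that, of w] unfolding eq .
    have "y \<in> w ` {k+1..n}" unfolding eq by (rule that)
    then obtain x where "x \<in> {k+1..n}" "y = w x" by (rule imageE)
    then show "inv w y \<in> {k+1..n}" by (simp add: inv)
  qed
  have lo: "w x \<in> {1..k}" "inv w x \<in> {1..k}" if "x \<in> {1..k}" for x
  proof -
    have x: "x \<in> {1..n}" "x \<notin> {k+1..n}" using that k by auto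
    have "w x \<notin> {k+1..n}" using hi(2)[of "w x"] x(2) unfolding inv by blast
    then show "w x \<in> {1..k}" using x(1) im(1)[of x] by auto
    have "inv w x \<notin> {k+1..n}" using hi(1)[of "inv w x"] x(2) unfolding inv by blast
    then show "inv w x \<in> {1..k}" using x(1) im(2)[of x] by auto
  qed
  have asc: "x \<le> inv w x" "inv w y \<le> y" "x \<le> w x" "w y \<le> y" if "x \<in> {1..k}" "y \<in> {k+1..n}" for x y
    using double_ascent[OF F w(1), of x y] lo[OF that(1)] hi[OF that(2)] that k by auto
  have "w x = x" for x
  proof -
    consider "x \<in> {1..k}" | "x \<in> {k+1..n}" | "x \<notin> {1..n}" by force
    then show ?thesis
    proof cases
      case 1
      \<comment> \<open>The bound for \<open>inv w\<close> at the point \<open>w x\<close> gives the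
        reverse inequality \<open>w x \<le> x\<close>.\<close>
      then have "x \<le> w x" "w x \<le> inv w (w x)"
        using asc(3)[of x n] asc(1)[of "w x" n] lo(1) k by auto
      then show ?thesis by (simp add: inv)
    next
      case 2
      then have "w x \<le> x" "inv w (w x) \<le> w x"
        using asc(4)[of 1 x] asc(2)[of 1 "w x"] hi(1) k by auto
      then show ?thesis by (simp add: inv)
    next
      case 3 then show ?thesis using pw permutes_not_in by metis
    qed
  qed
  then show False using w(2) by auto
qed

section \<open>Right-to-left minima, recorded by position\<close>

definition right_min :: "nat \<Rightarrow> (nat \<Rightarrow> nat) \<Rightarrow> nat \<Rightarrow> bool" where
  "right_min n u a \<longleftrightarrow> a \<in> {1..n} \<and> (\<forall>y. a < y \<longrightarrow> y \<le> n \<longrightarrow> u a < u y)"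

text \<open>Otherwise \<open>(a, y)\<close> is a double ascent, so \<open>a \<le> u a\<close>. All
  values after position \<open>a\<close> then exceed \<open>a\<close>, and the tail after
  \<open>a\<close> is invariant, against \<open>no_invariant_tail\<close>.\<close>

lemma right_min_inv_less:
  assumes F: "stable n F" and u: "u \<in> F" "u \<noteq> id" and a: "right_min n u a" and y: "a < y" "y \<le> n"
  shows "inv u y < inv u a"
proof (rule ccontr)
  assume neg: "\<not> inv u y < inv u a"
  note pu = stableD(1)[OF F u(1)]
  have "inv u a < inv u y"
    using neg permutes_less_or_greater[OF permutes_inv[OF pu], of a y] y by auto
  moreover have "u a < u y" using a y by (simp add: right_min_def)
  moreover have mem: "a \<in> {1..n}" "y \<in> {1..n}" using a y by (auto simp: right_min_def)
  ultimately have "a \<le> u a" using double_ascent(3)[OF F u(1) _ _ y(1)] by blast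
  moreover obtain z where "z \<in> {a+1..n}" "u z \<le> a"
    using no_invariant_tail[OF F u, of a] mem y by auto
  moreover have "u a < u z"
    using a \<open>z \<in> {a+1..n}\<close> by (simp add: right_min_def)
  ultimately show False by linarith
qed

text \<open>By \<open>right_min_inv_less\<close>, every value of \<open>u\<close> after position
  \<open>inv u a\<close> is below \<open>a\<close>. All pairs starting at that position are
  therefore inversions of \<open>u\<close>, and none is one of \<open>w\<close>.\<close>

lemma right_min_transfer:
  assumes F: "stable n F" and u: "u \<in> F" "u \<noteq> id" and a: "right_min n u a"
    and w: "w permutes {1..n}" and disj: "inversions n u \<inter> inversions n w = {}"
  shows "right_min n w (inv u a)"
  unfolding right_min_def
proof (intro conjI allI impI)
  note pu = stableD(1)[OF F u(1)]
  note inv = permutes_inverses[OF pu]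
  show mem: "inv u a \<in> {1..n}"
    using a permutes_in_image[OF permutes_inv[OF pu]] unfolding right_min_def by blast
  fix y assume y: "inv u a < y" "y \<le> n"
  have "u y \<le> n" using permutes_in_image[OF pu, of y] y mem by auto
  have "\<not> a < u y"
    using right_min_inv_less[OF F u a _ \<open>u y \<le> n\<close>] y(1) by (auto simp: inv)
  moreover have "u y \<noteq> a" using y(1) inv(2)[of y] by auto
  ultimately have "(inv u a, y) \<in> inversions n u"
    using mem y by (auto simp: inversions_def inv)
  then have "(inv u a, y) \<notin> inversions n w" using disj by blast
  then show "w (inv u a) < w y"
    using permutes_less_or_greater[OF w, of "inv u a" y] y mem by (auto simp: inversions_def)
qed

text \<open>If some points moved up, the largest such point would be sent to a larger one that moves
  up as well; dually for points that move down.\<close>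

lemma strict_mono_self_map_id:
  fixes A :: "nat set"
  assumes fin: "finite A" and self: "\<And>x. x \<in> A \<Longrightarrow> g x \<in> A"
    and mono: "\<And>x y. x \<in> A \<Longrightarrow> y \<in> A \<Longrightarrow> x < y \<Longrightarrow> g x < g y"
    and x: "x \<in> A"
  shows "g x = x"
proof -
  have "{x \<in> A. x < g x} = {}"
  proof (rule ccontr)
    assume ne: "{x \<in> A. x < g x} \<noteq> {}"
    define m where "m = Max {x \<in> A. x < g x}"
    have m: "m \<in> {x \<in> A. x < g x}" unfolding m_def using fin ne by (intro Max_in) auto
    then have "g m \<in> {x \<in> A. x < g x}" using self mono by blast
    then have "g m \<le> m" unfolding m_def using fin by (intro Max_ge) auto
    then show False using m by auto
  qed
  moreover have "{x \<in> A. g x < x} = {}"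
  proof (rule ccontr)
    assume ne: "{x \<in> A. g x < x} \<noteq> {}"
    define m where "m = Min {x \<in> A. g x < x}"
    have m: "m \<in> {x \<in> A. g x < x}" unfolding m_def using fin ne by (intro Min_in) auto
    then have "g m \<in> {x \<in> A. g x < x}" using self mono by blast
    then have "m \<le> g m" unfolding m_def using fin by (intro Min_le) auto
    then show False using m by auto
  qed
  ultimately have "\<not> x < g x" "\<not> g x < x" using x by blast+
  then show ?thesis by simp
qed

text \<open>Transferring right-to-left minima from \<open>u\<close> to \<open>w\<close> and back
  reverses order twice, so \<open>g\<close> is a strictly monotone self-map of a finite set. The
  position \<open>n\<close> is always a right-to-left minimum, hence a fixed point of
  \<open>g\<close>.\<close>

lemma disjoint_inversions_agree:
  assumes F: "stable n F" "w \<in> F" "w \<noteq> id" and G: "stable n G" "u \<in> G" "u \<noteq> id"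
    and disj: "inversions n u \<inter> inversions n w = {}" and n: "1 \<le> n"
  shows "w n = inv u n"
proof -
  note pw = stableD(1)[OF F(1,2)] and pu = stableD(1)[OF G(1,2)]
  have disj': "inversions n w \<inter> inversions n u = {}" using disj by blast
  define A where "A = {a. right_min n u a}"
  define g where "g = (\<lambda>a. inv w (inv u a))"
  have "g n = n"
  proof (rule strict_mono_self_map_id[where A = A])
    show "finite A" by (rule finite_subset[of _ "{1..n}"]) (auto simp: A_def right_min_def)
    show "n \<in> A" using n by (simp add: A_def right_min_def)
    fix x assume x: "x \<in> A"
    then have rx: "right_min n w (inv u x)"
      using right_min_transfer[OF G _ pw disj] by (simp add: A_def)
    then show "g x \<in> A"
      using right_min_transfer[OF F _ pu disj'] by (simp add: A_def g_def)
    fix y assume y: "y \<in> A" "x < y"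
    have ry: "right_min n w (inv u y)"
      using right_min_transfer[OF G _ pw disj] y by (simp add: A_def)
    have "y \<le> n" using y(1) by (simp add: A_def right_min_def)
    then have "inv u y < inv u x"
      using right_min_inv_less[OF G] x y(2) by (simp add: A_def)
    moreover have "inv u x \<le> n" using rx by (simp add: right_min_def)
    ultimately show "g x < g y"
      using right_min_inv_less[OF F ry] by (simp add: g_def)
  qed
  then have "w (inv w (inv u n)) = w n" by (simp add: g_def)
  then show ?thesis by (simp add: permutes_inverses[OF pw])
qed

text \<open>A common inversion \<open>(a, b)\<close> would give the inversion
  \<open>(inv x b, inv x a)\<close> of \<open>x\<close>, which \<open>u\<close> undoes.\<close>

lemma length_additive_disjoint_inversions:
  assumes u: "u permutes {1..n}" and x: "x permutes {1..n}" and add: "length_additive n u x"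
  shows "inversions n u \<inter> inversions n (inv x) = {}"
proof (rule ccontr)
  note inv = permutes_inverses[OF x]
  assume "inversions n u \<inter> inversions n (inv x) \<noteq> {}"
  then obtain a b where ab: "a \<in> {1..n}" "b \<in> {1..n}" "a < b" "u b < u a" "inv x b < inv x a"
    by (auto simp: inversions_def)
  have "inv x a \<in> {1..n}" "inv x b \<in> {1..n}"
    using ab permutes_in_image[OF permutes_inv[OF x]] by blast+
  then have "x (inv x a) < x (inv x b) \<longrightarrow> u (x (inv x a)) < u (x (inv x b))"
    using add ab(5) unfolding length_additive_def by blast
  then show False using ab by (simp add: inv)
qed

lemma inv_neq_id:
  assumes "x permutes S" "x \<noteq> id" shows "inv x \<noteq> id"
  using assms permutes_inv_inv[OF assms(1)] by (metis inv_id)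

section \<open>Additive pairs agree on the orbit of \<open>n\<close>\<close>

lemma length_additive_agree:
  assumes F: "stable n F" "x \<in> F" "x \<noteq> id" and G: "stable n G" "u \<in> G" "u \<noteq> id"
    and add: "length_additive n u x" and n: "1 \<le> n"
  shows "u n = x n"
proof -
  note px = stableD(1)[OF F(1,2)] and pu = stableD(1)[OF G(1,2)]
  have "inversions n (inv x) \<inter> inversions n u = {}"
    using length_additive_disjoint_inversions[OF pu px add] by blast
  then have "u n = inv (inv x) n"
    using disjoint_inversions_agree[OF G stable_inv[OF F(1)] imageI[OF F(2)] inv_neq_id[OF px F(3)]] n
    by blast
  then show ?thesis by (simp add: permutes_inv_inv[OF px])
qed

text \<open>With \<open>v = inv x \<circ> u \<circ> x\<close>, the factorisation
  \<open>u \<circ> x = x \<circ> v\<close> is additive again, with the two stable sets exchanged;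
  the induction must therefore generalise over both. Since \<open>x\<close> intertwines
  \<open>v\<close> and \<open>u\<close>, the hypothesis for \<open>(x, v)\<close> advances the orbit
  of \<open>n\<close> by one step.\<close>

lemma length_additive_agree_orbit:
  assumes "stable n F" "x \<in> F" "x \<noteq> id" and "stable n G" "u \<in> G" "u \<noteq> id"
    and "length_additive n u x" and n: "1 \<le> n"
  shows "(u ^^ m) n = (x ^^ m) n"
  using assms(1-7)
proof (induction m arbitrary: F G u x)
  case (Suc m)
  note F = Suc.prems(1-3) and G = Suc.prems(4-6) and add = Suc.prems(7)
  note px = stableD(1)[OF F(1,2)]
  define v where "v = inv x \<circ> u \<circ> x"
  have v: "v \<in> G" "length_additive n x v"
    using stableD(4,5)[OF G(1,2) px add] by (simp_all add: v_def)
  have xv: "x \<circ> v = u \<circ> x" by (simp add: v_def fun_eq_iff permutes_inverses[OF px])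
  have "v \<noteq> id"
  proof
    assume "v = id"
    then have "u (x y) = x y" for y using xv by (simp add: fun_eq_iff)
    then have "u z = z" for z using permutes_inverses(1)[OF px, of z] by metis
    then show False using G(3) by auto
  qed
  then have "(x ^^ m) n = (v ^^ m) n" by (intro Suc.IH[OF G(1) v(1) _ F v(2)])
  moreover have "x ((v ^^ m) y) = (u ^^ m) (x y)" for y
    using xv by (induction m) (simp_all add: fun_eq_iff)
  ultimately have "x ((x ^^ m) n) = (u ^^ m) (x n)" by simp
  then show ?case
    using length_additive_agree[OF F G add n] by (simp add: funpow_swap1)
qed simp

section \<open>Excluding the four-cycle\<close>

text \<open>Suppose \<open>x y < x l\<close> for \<open>l = x n\<close> and some \<open>y\<close> in
  \<open>Q\<close>. As \<open>inv x l = n\<close> is maximal, also \<open>inv x y < inv x l\<close>.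
  If \<open>y < l\<close>, the double ascent gives \<open>n \<le> l\<close>; if
  \<open>l < y\<close>, then \<open>(l, y)\<close> is a common inversion of \<open>x\<close> and
  \<open>inv x\<close>.\<close>

lemma twice_is_min:
  assumes F: "stable n F" "x \<in> F" "x n \<noteq> n" and n: "1 \<le> n"
    and O: "Q \<subseteq> {1..n}" "x ` Q = Q" "n \<in> Q"
    and disj: "\<And>a b. a \<in> Q \<Longrightarrow> b \<in> Q \<Longrightarrow> a < b \<Longrightarrow> x b < x a \<Longrightarrow> inv x a < inv x b"
    and z: "z \<in> Q"
  shows "x (x n) \<le> z"
proof (rule ccontr)
  assume neg: "\<not> ?thesis"
  note px = stableD(1)[OF F(1,2)]
  note inv = permutes_inverses[OF px]
  define l where "l = x n"
  have l: "l \<in> Q" "inv x l = n" using O by (auto simp: l_def inv)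
  then have "l < n" using O(1) F(3) by (auto simp: l_def order_less_le)
  obtain y where y: "y \<in> Q" "z = x y" using z O(2) by auto
  have less: "x y < x l" using neg y by (simp add: l_def)
  have "inv x y \<in> {1..n}" using permutes_in_image[OF permutes_inv[OF px]] y O(1) by blast
  moreover have "inv x y \<noteq> n"
  proof
    assume "inv x y = n"
    then have "y = l" using inv(1)[of y] by (simp add: l_def)
    then show False using less by simp
  qed
  ultimately have asc: "inv x y < inv x l" using l by auto
  have "y \<noteq> l" using less by auto
  then consider "y < l" | "l < y" by linarith
  then show False
  proof cases
    case 1
    then have "inv x l \<le> l"
      using double_ascent(2)[OF F(1,2) _ _ 1 less asc] y l O(1) by blast
    then show False using l \<open>l < n\<close> by simp
  next
    case 2
    then show False using disj[OF l(1) y(1) 2 less] asc by simp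
  qed
qed

text \<open>Conjugation by the transposition of \<open>q - 1\<close> and \<open>q\<close> stays in
  \<open>F\<close> because \<open>w q = n\<close> is maximal. It lowers \<open>q\<close> by one
  until \<open>q\<close> meets \<open>m\<close>.\<close>

lemma no_four_cycle:
  assumes F: "stable n F"
  shows "w \<in> F \<Longrightarrow> w m = q \<Longrightarrow> w q = n \<Longrightarrow> w n = l \<Longrightarrow> w l = m \<Longrightarrow>
    1 \<le> m \<Longrightarrow> m < q \<Longrightarrow> q < l \<Longrightarrow> l < n \<Longrightarrow> False"
proof (induction q arbitrary: w rule: less_induct)
  case (less q)
  note pw = stableD(1)[OF F less.prems(1)]
  define i where "i = q - 1"
  have i: "i \<in> {1..<n}" "q = i + 1" "m \<le> i" using less.prems by (auto simp: i_def)
  have "w i \<noteq> n"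
    using injD[OF permutes_inj[OF pw], of i q] less.prems(3) i(2) by auto
  then have "w i < w (i + 1)"
    using permutes_in_image[OF pw, of i] i less.prems(3) by auto
  then have "length_additive n w (adj i)"
    unfolding length_additive_def
  proof (intro ballI impI)
    fix a b assume "a < b" "adj i b < adj i a"
    then have "b = i + 1" "a = i" using adj_reverses by blast+
    then show "w (adj i b) < w (adj i a)" using \<open>w i < w (i + 1)\<close> by simp
  qed
  then have w': "adj i \<circ> w \<circ> adj i \<in> F"
    using stableD(4)[OF F less.prems(1) adj_permutes[OF i(1)]] by simp
  show False
  proof (cases "m = i")
    case False
    show False
    proof (rule less.IH[OF _ w'])
      show "i < q" using i by simp
    qed (use less.prems i False in \<open>auto simp: transpose_def\<close>)
  next
    case True
    \<comment> \<open>The conjugate has the cycle \<open>q\<close>, \<open>m\<close>,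
      \<open>n\<close>, \<open>l\<close>. Here \<open>(q, l)\<close> is a double ascent, yet
      \<open>?v q = m\<close> lies below \<open>q\<close>.\<close>
    let ?v = "adj i \<circ> w \<circ> adj i"
    note pv = stableD(1)[OF F w']
    have v: "?v q = m" "?v l = q" "?v m = n" "?v n = l"
      using less.prems i True by (auto simp: transpose_def)
    have "inv ?v q = l" "inv ?v l = n"
      using v permutes_inv_eq[OF pv] by blast+
    then have "q \<le> ?v q"
      using double_ascent(3)[OF F w', of q l] v less.prems by simp
    then show False using v less.prems by simp
  qed
qed

text \<open>On the orbit \<open>Q\<close> of \<open>n\<close>, \<open>u\<close> equals
  \<open>x\<close>, so \<open>x\<close> and \<open>inv x\<close> have no common inversion there. By
  \<open>twice_is_min\<close> for \<open>x\<close> and for \<open>inv x\<close>, two steps forward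
  and two steps backward from \<open>n\<close> both reach the minimum of \<open>Q\<close>; hence
  \<open>Q\<close> is a four-cycle.\<close>

lemma stable_not_additive:
  assumes F: "stable n F" "x \<in> F" "x \<noteq> id" and G: "stable n G" "u \<in> G" "u \<noteq> id"
  shows "\<not> length_additive n u x"
proof
  assume add: "length_additive n u x"
  note px = stableD(1)[OF F(1,2)] and pu = stableD(1)[OF G(1,2)]
  note inv = permutes_inverses[OF px]
  have n: "2 \<le> n"
  proof (rule ccontr)
    assume "\<not> 2 \<le> n"
    then have "{1..n} = {} \<or> {1..n} = {1}" by auto
    then show False using px F(3) by auto
  qed
  then have n1: "1 \<le> n" by simp
  define Q where "Q = range (\<lambda>m. (x ^^ m) n)"
  have nQ: "n \<in> Q" unfolding Q_def using rangeI[of "\<lambda>m. (x ^^ m) n" 0] by simp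
  have sub: "Q \<subseteq> {1..n}"
  proof -
    have "(x ^^ m) n \<in> {1..n}" for m
      using n1 permutes_in_image[OF px] by (induction m) auto
    then show ?thesis by (auto simp: Q_def)
  qed
  have "x ((x ^^ m) n) \<in> Q" for m
    unfolding Q_def using rangeI[of "\<lambda>m. (x ^^ m) n" "Suc m"] by simp
  then have "x ` Q \<subseteq> Q" by (auto simp: Q_def)
  then have xQ: "x ` Q = Q"
    using finite_subset[OF sub] permutes_inj_on[OF px] by (intro endo_inj_surj) simp_all
  have "inv x ` x ` Q = Q" by (simp add: image_comp permutes_inv_o(2)[OF px])
  then have ixQ: "inv x ` Q = Q" by (simp only: xQ)
  have ux: "u y = x y" if "y \<in> Q" for y
  proof -
    from that obtain m where m: "y = (x ^^ m) n" by (auto simp: Q_def)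
    show ?thesis
      using length_additive_agree_orbit[OF F G add n1, of m] length_additive_agree_orbit[OF F G add n1, of "Suc m"] m by simp
  qed
  have disj: "inv x a < inv x b" if "a \<in> Q" "b \<in> Q" "a < b" "x b < x a" for a b
  proof -
    have "(a, b) \<in> inversions n u" using that ux sub by (auto simp: inversions_def)
    then have "(a, b) \<notin> inversions n (inv x)"
      using length_additive_disjoint_inversions[OF pu px add] by blast
    then show ?thesis
      using that sub permutes_less_or_greater[OF permutes_inv[OF px], of a b]
      by (auto simp: inversions_def)
  qed
  have disj': "x a < x b" if "a \<in> Q" "b \<in> Q" "a < b" "inv x b < inv x a" for a b
    using disj[OF that(1-3)] that permutes_less_or_greater[OF px, of a b] by auto
  \<comment> \<open>The tail is taken to be \<open>{n}\<close> alone, so its failure to be invariant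
    says that \<open>x\<close> moves \<open>n\<close>.\<close>
  have "\<exists>y\<in>{n - 1 + 1..n}. x y \<le> n - 1"
    using n by (intro no_invariant_tail[OF F]) auto
  then have fix1: "x n \<noteq> n" using n by auto
  then have fix2: "inv x n \<noteq> n" using inv(1)[of n] by metis
  define l q m where "l = x n" and "q = inv x n" and "m = x l"
  have Q: "l \<in> Q" "q \<in> Q" "m \<in> Q" "inv x q \<in> Q"
    using nQ xQ ixQ unfolding l_def q_def m_def by blast+
  have min: "m \<le> z" "inv x q \<le> z" if "z \<in> Q" for z
  proof -
    show "m \<le> z" unfolding m_def l_def
      by (rule twice_is_min[OF F(1,2) fix1 n1 sub xQ nQ disj that])
    have ii: "inv (inv x) = x" by (rule permutes_inv_inv[OF px])
    show "inv x q \<le> z" unfolding q_def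
      by (rule twice_is_min[OF stable_inv[OF F(1)] imageI[OF F(2)] fix2 n1 sub ixQ nQ _ that])
        (simp add: ii disj')
  qed
  have "inv x q = m" using min(1)[OF Q(4)] min(2)[OF Q(3)] by simp
  then have x: "x m = q" "x q = n" "x n = l" "x l = m"
    using inv(1)[of q] by (simp_all add: q_def l_def m_def inv)
  have ln: "l < n" "q < n" using Q(1,2) sub fix1 fix2 unfolding l_def q_def by (auto simp: order_less_le)
  have "m \<noteq> l"
  proof
    assume "m = l"
    then have "x l = x n" using x by simp
    then show False using ln injD[OF permutes_inj[OF px]] by blast
  qed
  moreover have "m \<noteq> q" using x ln(2) by auto
  ultimately have m: "m < l" "m < q" using min(1) Q by (simp_all add: order_less_le)
  have "1 \<le> m" using Q(3) sub by auto
  have "l \<noteq> q" using x m ln by auto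
  then consider "q < l" | "l < q" by linarith
  then show False
  proof cases
    case 1
    show False by (rule no_four_cycle[OF F(1,2) x]) (use 1 m ln \<open>1 \<le> m\<close> in auto)
  next
    case 2
    \<comment> \<open>Passing to \<open>inv x\<close> interchanges \<open>l\<close> and
      \<open>q\<close> and restores the order needed.\<close>
    have "inv x m = l" "inv x l = n" "inv x n = q" "inv x q = m"
      using x by (simp_all add: permutes_inv_eq[OF px])
    from no_four_cycle[OF stable_inv[OF F(1)] imageI[OF F(2)] this] show False
      using 2 m ln \<open>1 \<le> m\<close> by auto
  qed
qed

subsection \<open>Reduced words and Matsumoto's theorem\<close>

lemma word_perm_simps:
  "word_perm [] = id"
  "word_perm (i # ws) = adj i \<circ> word_perm ws"
  by (simp_all add: word_perm_def)

lemma word_perm_append: "word_perm (us @ vs) = word_perm us \<circ> word_perm vs"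
  by (induction us) (simp_all add: word_perm_simps comp_assoc)

lemma word_perm_permutes:
  fixes n :: nat
  shows "set ws \<subseteq> {1..<n} \<Longrightarrow> word_perm ws permutes {1..n}"
proof (induction ws)
  case Nil then show ?case using permutes_id[of "{1..n}"] by (simp add: word_perm_simps id_def)
next
  case (Cons i ws)
  then have "adj i permutes {1..n}" "word_perm ws permutes {1..n}"
    using adj_permutes[of i n] by simp_all
  then have "adj i \<circ> word_perm ws permutes {1..n}" by (rule permutes_compose[rotated])
  then show ?case by (simp add: word_perm_simps comp_def)
qed

lemma ninv_id [simp]: "ninv n id = 0"
proof -
  have "inversions n id = {}" by (auto simp: inversions_def)
  then show ?thesis by (simp add: ninv_def)
qed

lemma ninv_word_perm_le:
  fixes n :: nat
  shows "set ws \<subseteq> {1..<n} \<Longrightarrow> ninv n (word_perm ws) \<le> length ws"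
proof (induction ws)
  case (Cons i ws)
  then have "ninv n (adj i \<circ> word_perm ws) \<le> ninv n (adj i) + ninv n (word_perm ws)"
    by (intro ninv_comp_le adj_permutes word_perm_permutes) auto
  then have "ninv n (word_perm (i # ws)) \<le> length (i # ws)"
    using Cons ninv_adj[of i n] by (simp add: word_perm_simps)
  then show ?case .
qed (use ninv_id[of n] in \<open>simp add: word_perm_simps id_def\<close>)

lemma increasing_permutation_id:
  fixes n :: nat
  assumes v: "v permutes {1..n}" and inc: "\<And>i. i \<in> {1..<n} \<Longrightarrow> v i < v (i + 1)"
  shows "v = id"
proof -
  have "1 \<le> i \<longrightarrow> i \<le> n \<longrightarrow> i \<le> v i" for i :: nat
  proof (induction i)
    case (Suc i)
    show ?case
    proof (cases "i = 0")
      case True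
      then show ?thesis using permutes_in_image[OF v, of 1] by auto
    next
      case False
      then show ?thesis using Suc inc[of i] by auto
    qed
  qed simp
  then have ge: "\<forall>i\<in>{1..n}. i \<le> v i" by simp
  show ?thesis by (rule permutes_natset_ge[OF v ge])
qed

text \<open>A left descent: the value \<open>i + 1\<close> stands before \<open>i\<close>, so
  \<open>adj i \<circ> w\<close> is shorter than \<open>w\<close>.\<close>

definition descent :: "nat \<Rightarrow> (nat \<Rightarrow> nat) \<Rightarrow> nat \<Rightarrow> bool" where
  "descent n w i \<longleftrightarrow> i \<in> {1..<n} \<and> inv w (i + 1) < inv w i"

text \<open>Stated through the inversion number so that it can be checked letter by letter;
  \<open>reduced_expression_iff\<close> identifies it with minimality of length.\<close>

definition reduced :: "nat \<Rightarrow> nat list \<Rightarrow> bool" where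
  "reduced n ws \<longleftrightarrow> set ws \<subseteq> {1..<n} \<and> length ws = ninv n (word_perm ws)"

lemma not_descent:
  assumes "w permutes {1..n}" "i \<in> {1..<n}" "\<not> descent n w i"
  shows "inv w i < inv w (i + 1)"
  using permutes_less_or_greater[OF permutes_inv[OF assms(1)], of i "i + 1"] assms(2,3)
  by (auto simp: descent_def)

lemma exists_descent:
  assumes w: "w permutes {1..n}" "w \<noteq> id"
  shows "\<exists>i. descent n w i"
proof (rule ccontr)
  assume "\<not> ?thesis"
  then have "inv w = id"
    using not_descent[OF w(1)] by (intro increasing_permutation_id[OF permutes_inv[OF w(1)]]) blast
  then show False using w permutes_inv_inv[OF w(1)] by (simp add: inv_id)
qed

lemma reduced_Cons_iff:
  "reduced n (i # ws) \<longleftrightarrow> i \<in> {1..<n} \<and> reduced n ws \<and> \<not> descent n (word_perm ws) i"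
proof (cases "i \<in> {1..<n} \<and> set ws \<subseteq> {1..<n}")
  case True
  then have i: "i \<in> {1..<n}" and ws: "set ws \<subseteq> {1..<n}" by auto
  note p = word_perm_permutes[OF ws]
  have le: "ninv n (word_perm ws) \<le> length ws" by (rule ninv_word_perm_le[OF ws])
  show ?thesis
  proof (cases "descent n (word_perm ws) i")
    case True
    then have "ninv n (adj i \<circ> word_perm ws) + 1 = ninv n (word_perm ws)"
      using ninv_adj_comp(2)[OF i p] by (simp add: descent_def)
    then have "ninv n (word_perm (i # ws)) \<noteq> length (i # ws)" using le by (simp add: word_perm_simps)
    then show ?thesis using True unfolding reduced_def by simp
  next
    case False
    then have "ninv n (adj i \<circ> word_perm ws) = ninv n (word_perm ws) + 1"
      using ninv_adj_comp(1)[OF i p] not_descent[OF p i] by blast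
    then show ?thesis using False i ws by (simp add: reduced_def word_perm_simps)
  qed
next
  case False then show ?thesis by (auto simp: reduced_def)
qed

lemma reduced_Cons_descent:
  assumes "reduced n (i # ws)" shows "descent n (word_perm (i # ws)) i"
proof -
  have i: "i \<in> {1..<n}" and ws: "reduced n ws" "\<not> descent n (word_perm ws) i"
    using assms by (simp_all add: reduced_Cons_iff)
  have p: "word_perm ws permutes {1..n}" using ws(1) by (intro word_perm_permutes) (simp add: reduced_def)
  show ?thesis
    using not_descent[OF p i ws(2)] i inv_adj_comp[OF p, of i i] inv_adj_comp[OF p, of i "i + 1"]
    by (simp add: descent_def word_perm_simps)
qed

text \<open>Stripping a left descent lowers the inversion number by one, and only the identity has
  no descent.\<close>

lemma reduced_exists:
  assumes "w permutes {1..n}"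
  shows "\<exists>ws. reduced n ws \<and> word_perm ws = w"
  using assms
proof (induction "ninv n w" arbitrary: w rule: less_induct)
  case less
  note p = less.prems
  show ?case
  proof (cases "w = id")
    case True
    then show ?thesis by (intro exI[of _ "[]"]) (simp add: reduced_def word_perm_simps)
  next
    case False
    then obtain i where d: "descent n w i" using exists_descent[OF p] by blast
    then have i: "i \<in> {1..<n}" by (simp add: descent_def)
    have p': "adj i \<circ> w permutes {1..n}"
      using permutes_compose[OF p adj_permutes[OF i]] .
    have "ninv n (adj i \<circ> w) + 1 = ninv n w"
      using ninv_adj_comp(2)[OF i p] d by (simp add: descent_def)
    then obtain ws where ws: "reduced n ws" "word_perm ws = adj i \<circ> w"
      using less.hyps[OF _ p'] by auto
    have "\<not> descent n (word_perm ws) i"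
      using d inv_adj_comp[OF p, of i i] inv_adj_comp[OF p, of i "i + 1"]
      by (simp add: descent_def ws(2))
    then have "reduced n (i # ws)" using ws i by (simp add: reduced_Cons_iff)
    moreover have "word_perm (i # ws) = w" using ws by (simp add: word_perm_simps)
    ultimately show ?thesis by blast
  qed
qed

text \<open>Any left descent can serve as first letter: prepend it to a reduced word of the shorter
  permutation \<open>adj i \<circ> w\<close>.\<close>

lemma descent_reduced:
  assumes p: "w permutes {1..n}" and d: "descent n w i"
  shows "\<exists>ws. reduced n (i # ws) \<and> word_perm (i # ws) = w"
proof -
  have i: "i \<in> {1..<n}" using d by (simp add: descent_def)
  have p': "adj i \<circ> w permutes {1..n}" using permutes_compose[OF p adj_permutes[OF i]] .
  obtain ws where ws: "reduced n ws" "word_perm ws = adj i \<circ> w"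
    using reduced_exists[OF p'] by auto
  have "\<not> descent n (word_perm ws) i"
    using d inv_adj_comp[OF p, of i i] inv_adj_comp[OF p, of i "i + 1"]
    by (simp add: descent_def ws(2))
  then have "reduced n (i # ws)" using ws i by (simp add: reduced_Cons_iff)
  moreover have "word_perm (i # ws) = w" using ws by (simp add: word_perm_simps)
  ultimately show ?thesis by blast
qed

text \<open>The inversion number bounds the length of every expression from below, and
  \<open>reduced_exists\<close> attains the bound.\<close>

lemma reduced_expression_iff:
  assumes "w permutes {1..n}"
  shows "reduced_expression n w ws \<longleftrightarrow> reduced n ws \<and> word_perm ws = w"
proof -
  obtain vs where vs: "reduced n vs" "word_perm vs = w" using reduced_exists[OF assms] by auto
  then have v: "expression_of n w vs" "length vs = ninv n w"
    by (auto simp: expression_of_def reduced_def)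
  have le: "ninv n w \<le> length us" if "expression_of n w us" for us
    using that ninv_word_perm_le by (auto simp: expression_of_def)
  show ?thesis
  proof
    assume "reduced_expression n w ws"
    then have e: "expression_of n w ws" "\<not> length vs < length ws"
      using v(1) by (auto simp: reduced_expression_def is_arg_min_def)
    then show "reduced n ws \<and> word_perm ws = w"
      using le[OF e(1)] v(2) by (auto simp: expression_of_def reduced_def)
  next
    assume "reduced n ws \<and> word_perm ws = w"
    then show "reduced_expression n w ws"
      using le by (force simp: reduced_expression_def is_arg_min_def expression_of_def reduced_def)
  qed
qed

lemma perm_length_eq_ninv:
  assumes "w permutes {1..n}" shows "perm_length n w = ninv n w"
  unfolding perm_length_def
proof (rule Least_equality)
  show "\<exists>ws. expression_of n w ws \<and> length ws = ninv n w"
    using reduced_exists[OF assms] by (auto simp: expression_of_def reduced_def)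
  show "ninv n w \<le> l" if "\<exists>ws. expression_of n w ws \<and> length ws = l" for l
    using that ninv_word_perm_le by (auto simp: expression_of_def)
qed

section \<open>Defining relations and words in the algebra\<close>

lemma nc_T_square:
  assumes "i \<in> {1..<CARD('n)}"
  shows "nc_T i * nc_T i = (0 :: ('n::finite, 'k::field) nilcoxeter)"
  using assms
proof transfer
  fix i assume "i \<in> {1..<CARD('n)}"
  then have "free_gen i * free_gen i \<in> (nc_relators :: ('n gen_word \<Rightarrow>\<^sub>0 'k) set)"
    unfolding nc_relators_def by blast
  then have "free_gen i * free_gen i - 0 \<in> two_sided_ideal (nc_relators :: ('n gen_word \<Rightarrow>\<^sub>0 'k) set)"
    unfolding diff_zero by (rule two_sided_ideal_base)
  then show "nc_rel (free_gen i * free_gen i :: 'n gen_word \<Rightarrow>\<^sub>0 'k) 0"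
    unfolding nc_rel_def .
qed

lemma nc_T_commute:
  assumes "i \<in> {1..<CARD('n)}" "j \<in> {1..<CARD('n)}" "i + 1 < j"
  shows "nc_T i * nc_T j = (nc_T j * nc_T i :: ('n::finite, 'k::field) nilcoxeter)"
  using assms
proof transfer
  fix i j assume "i \<in> {1..<CARD('n)}" "j \<in> {1..<CARD('n)}" "i + 1 < j"
  moreover from this have "\<bar>int i - int j\<bar> > 1" by linarith
  ultimately have "free_gen i * free_gen j - free_gen j * free_gen i
      \<in> (nc_relators :: ('n gen_word \<Rightarrow>\<^sub>0 'k) set)"
    unfolding nc_relators_def by blast
  then show "nc_rel (free_gen i * free_gen j :: 'n gen_word \<Rightarrow>\<^sub>0 'k) (free_gen j * free_gen i)"
    unfolding nc_rel_def by (rule two_sided_ideal_base)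
qed

lemma nc_T_braid:
  assumes "1 \<le> i" "i + 1 < CARD('n)"
  shows "nc_T i * nc_T (i + 1) * nc_T i
    = (nc_T (i + 1) * nc_T i * nc_T (i + 1) :: ('n::finite, 'k::field) nilcoxeter)"
  using assms
proof transfer
  fix i assume "1 \<le> i" "i + 1 < CARD('n)"
  then have "free_gen i * free_gen (i + 1) * free_gen i - free_gen (i + 1) * free_gen i * free_gen (i + 1)
      \<in> (nc_relators :: ('n gen_word \<Rightarrow>\<^sub>0 'k) set)"
    unfolding nc_relators_def by blast
  then show "nc_rel (free_gen i * free_gen (i + 1) * free_gen i :: 'n gen_word \<Rightarrow>\<^sub>0 'k)
      (free_gen (i + 1) * free_gen i * free_gen (i + 1))"
    unfolding nc_rel_def by (rule two_sided_ideal_base)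
qed

abbreviation nc_word :: "nat list \<Rightarrow> ('n::finite, 'k::field) nilcoxeter" where
  "nc_word ws \<equiv> prod_list (map nc_T ws)"

lemma adj_commute: "i + 1 < j \<Longrightarrow> adj i \<circ> (adj j \<circ> w) = adj j \<circ> (adj i \<circ> w)"
  by (rule ext) (simp add: transpose_def)

lemma adj_braid: "adj i \<circ> (adj (i + 1) \<circ> (adj i \<circ> w)) = adj (i + 1) \<circ> (adj i \<circ> (adj (i + 1) \<circ> w))"
  by (rule ext) (simp add: transpose_def)

text \<open>With two descents, \<open>w\<close> factors additively through the longest element of
  the subgroup generated by \<open>adj i\<close> and \<open>adj j\<close>. The two reduced words of
  that element differ by one commutation or one braid relation.\<close>

lemma two_descents:
  assumes p: "w permutes {1..CARD('n)}" and d: "descent CARD('n) w i" "descent CARD('n) w j"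
    and ij: "i < j"
  shows "\<exists>us vs. reduced CARD('n) (i # us) \<and> reduced CARD('n) (j # vs) \<and>
    word_perm (i # us) = w \<and> word_perm (j # vs) = w \<and>
    nc_word (i # us) = (nc_word (j # vs) :: ('n::finite, 'k::field) nilcoxeter)"
proof -
  let ?n = "CARD('n)"
  note inv = permutes_inverses[OF p]
  have i: "i \<in> {1..<?n}" and j: "j \<in> {1..<?n}" using d by (auto simp: descent_def)
  note pi = permutes_compose[OF _ adj_permutes[OF i]] and pj = permutes_compose[OF _ adj_permutes[OF j]]
  have di: "inv w (i + 1) < inv w i" and dj: "inv w (j + 1) < inv w j" using d by (auto simp: descent_def)
  show ?thesis
  proof (cases "i + 1 = j")
    case False
    then have far: "i + 1 < j" using ij by simp
    \<comment> \<open>\<open>v\<close> is \<open>w\<close> with the commuting factor removed; the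
      letters are put back in both orders, and \<open>reduced_Cons_iff\<close> is checked at
      each.\<close>
    define v where "v = adj i \<circ> (adj j \<circ> w)"
    have pv: "v permutes {1..?n}" unfolding v_def by (intro pi pj p)
    obtain c where c: "reduced ?n c" "word_perm c = v" using reduced_exists[OF pv] by blast
    have iv: "inv v x = inv w (adj j (adj i x))" for x
      unfolding v_def by (simp only: inv_adj_comp[OF pj[OF p]] inv_adj_comp[OF p])
    have "reduced ?n (j # c)" "reduced ?n (i # c)"
      using c i j di dj far by (auto simp: reduced_Cons_iff descent_def iv transpose_def)
    moreover have wj: "word_perm (j # c) = adj i \<circ> w"
      using c(2) by (simp add: word_perm_simps v_def adj_commute[OF far])
    moreover have wi: "word_perm (i # c) = adj j \<circ> w"
      using c(2) by (simp add: word_perm_simps v_def)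
    moreover have "inv (adj i \<circ> w) x = inv w (adj i x)" "inv (adj j \<circ> w) x = inv w (adj j x)" for x
      by (rule inv_adj_comp[OF p])+
    ultimately have "reduced ?n (i # j # c)" "reduced ?n (j # i # c)"
      using i j di dj unfolding reduced_Cons_iff[of _ i "j # c"] reduced_Cons_iff[of _ j "i # c"] wi wj
      by (simp_all add: descent_def)
    moreover have "word_perm (i # j # c) = w" "word_perm (j # i # c) = w"
      using wi wj by (simp_all only: word_perm_simps(2)[of i "j # c"] word_perm_simps(2)[of j "i # c"] adj_adj)
    moreover have "nc_word (i # j # c) = (nc_word (j # i # c) :: ('n, 'k) nilcoxeter)"
      using nc_T_commute[OF i j far, where 'k = 'k] by (simp flip: mult.assoc)
    ultimately show ?thesis by blast
  next
    case True
    \<comment> \<open>Now the longest element of a copy of the symmetric group on three letters is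
      removed, by either of its two braid words.\<close>
    define v where "v = adj i \<circ> (adj j \<circ> (adj i \<circ> w))"
    have v': "v = adj j \<circ> (adj i \<circ> (adj j \<circ> w))" unfolding v_def True[symmetric] by (rule adj_braid)
    have pv: "v permutes {1..?n}" unfolding v_def by (intro pi pj p)
    obtain c where c: "reduced ?n c" "word_perm c = v" using reduced_exists[OF pv] by blast
    have iv: "inv v x = inv w (adj i (adj j (adj i x)))" for x
      unfolding v_def by (simp only: inv_adj_comp[OF pj[OF pi[OF p]]] inv_adj_comp[OF pi[OF p]] inv_adj_comp[OF p])
    have r1: "reduced ?n (i # c)" "reduced ?n (j # c)"
      using c i j di dj True by (auto simp: reduced_Cons_iff descent_def iv transpose_def)
    have w1: "word_perm (i # c) = adj j \<circ> (adj i \<circ> w)" "word_perm (j # c) = adj i \<circ> (adj j \<circ> w)"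
      using c(2) by (simp add: word_perm_simps v_def, simp add: word_perm_simps v')
    have i1: "inv (adj j \<circ> (adj i \<circ> w)) x = inv w (adj i (adj j x))"
      "inv (adj i \<circ> (adj j \<circ> w)) x = inv w (adj j (adj i x))" for x
      by (simp_all only: inv_adj_comp[OF pi[OF p]] inv_adj_comp[OF pj[OF p]] inv_adj_comp[OF p])
    have nd: "\<not> descent ?n (adj j \<circ> (adj i \<circ> w)) j" "\<not> descent ?n (adj i \<circ> (adj j \<circ> w)) i"
      unfolding descent_def i1 using di dj True by auto
    have r2: "reduced ?n (j # i # c)" "reduced ?n (i # j # c)"
      using r1 i j nd
      unfolding reduced_Cons_iff[of _ i "j # c"] reduced_Cons_iff[of _ j "i # c"] w1
      by blast+
    have w2: "word_perm (j # i # c) = adj i \<circ> w" "word_perm (i # j # c) = adj j \<circ> w"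
      using w1 by (simp_all only: word_perm_simps(2)[of i "j # c"] word_perm_simps(2)[of j "i # c"] adj_adj)
    have i2: "inv (adj i \<circ> w) x = inv w (adj i x)" "inv (adj j \<circ> w) x = inv w (adj j x)" for x
      by (rule inv_adj_comp[OF p])+
    have r3: "reduced ?n (i # j # i # c)" "reduced ?n (j # i # j # c)"
      using r2 i j di dj
      unfolding reduced_Cons_iff[of _ i "j # i # c"] reduced_Cons_iff[of _ j "i # j # c"] w2
      by (simp_all add: descent_def i2)
    have w3: "word_perm (i # j # i # c) = w" "word_perm (j # i # j # c) = w"
      using w2 by (simp_all only: word_perm_simps(2)[of i "j # i # c"] word_perm_simps(2)[of j "i # j # c"] adj_adj)
    have "nc_word (i # j # i # c) = (nc_word (j # i # j # c) :: ('n, 'k) nilcoxeter)"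
      using nc_T_braid[where 'n = 'n and 'k = 'k, of i] i j True by (simp flip: mult.assoc)
    then show ?thesis using r3 w3 by blast
  qed
qed

text \<open>Induction on length: words with the same first letter reduce to their tails. If the
  first letters differ, both are descents, and the words from \<open>two_descents\<close> form a
  bridge, each sharing its first letter with one of the given words.\<close>

lemma matsumoto:
  assumes "reduced CARD('n) us" "reduced CARD('n) vs" "word_perm us = word_perm vs"
  shows "nc_word us = (nc_word vs :: ('n::finite, 'k::field) nilcoxeter)"
  using assms
proof (induction "length us" arbitrary: us vs rule: less_induct)
  case less
  note us = less.prems(1) and vs = less.prems(2) and eq = less.prems(3)
  have len: "length us = length vs" using us vs eq by (simp add: reduced_def)
  show ?case
  proof (cases us)
    case Nil then show ?thesis using len by simp
  next
    case (Cons i us')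
    then obtain j vs' where V: "vs = j # vs'" using len by (cases vs) auto
    have IH: "nc_word as = (nc_word bs :: ('n, 'k) nilcoxeter)"
      if "reduced CARD('n) (k # as)" "reduced CARD('n) (k # bs)" "length (k # as) = length us"
        "word_perm (k # as) = word_perm (k # bs)" for k as bs
    proof (rule less.hyps)
      show "length as < length us" using that(3) by simp
      show "reduced CARD('n) as" "reduced CARD('n) bs" using that by (simp_all add: reduced_Cons_iff)
      have "adj k \<circ> (adj k \<circ> word_perm as) = adj k \<circ> (adj k \<circ> word_perm bs)" using that(4) by (simp add: word_perm_simps)
      then show "word_perm as = word_perm bs" by (simp only: adj_adj)
    qed
    have p: "word_perm us permutes {1..CARD('n)}"
      using us by (intro word_perm_permutes) (simp add: reduced_def)
    have d: "descent CARD('n) (word_perm us) i" "descent CARD('n) (word_perm us) j"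
      using reduced_Cons_descent us vs eq unfolding Cons V by metis+
    have join: "nc_word us = (nc_word vs :: ('n, 'k) nilcoxeter)"
      if "reduced CARD('n) (i # as)" "reduced CARD('n) (j # bs)"
        "word_perm (i # as) = word_perm us" "word_perm (j # bs) = word_perm us"
        "nc_word (i # as) = (nc_word (j # bs) :: ('n, 'k) nilcoxeter)" for as bs
    proof -
      have l: "length (i # as) = length us" "length (j # bs) = length us"
        using that us by (simp_all only: reduced_def)
      have "nc_word as = (nc_word us' :: ('n, 'k) nilcoxeter)"
        by (rule IH[of i]) (use that us l Cons in simp_all)
      moreover have "nc_word bs = (nc_word vs' :: ('n, 'k) nilcoxeter)"
        by (rule IH[of j]) (use that vs l V eq in simp_all)
      ultimately show ?thesis using that(5) by (simp add: Cons V)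
    qed
    consider "i = j" | "i < j" | "j < i" by linarith
    then show ?thesis
    proof cases
      case 1
      then have "nc_word us' = (nc_word vs' :: ('n, 'k) nilcoxeter)"
        using us vs eq Cons V by (intro IH[of i]) simp_all
      then show ?thesis using 1 Cons V by simp
    next
      case 2
      then show ?thesis using two_descents[OF p d 2, where 'k = 'k] join by blast
    next
      case 3
      then show ?thesis using two_descents[OF p d(2,1) 3, where 'k = 'k] join by metis
    qed
  qed
qed

text \<open>Where reducedness first fails, reading from the right, the new letter is a descent of a
  reduced suffix. By \<open>matsumoto\<close> that suffix may be rewritten to start with the same
  letter, and a square appears.\<close>

lemma nc_word_not_reduced:
  assumes "set ws \<subseteq> {1..<CARD('n)}" "\<not> reduced CARD('n) ws"
  shows "nc_word ws = (0 :: ('n::finite, 'k::field) nilcoxeter)"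
  using assms
proof (induction ws)
  case Nil then show ?case by (simp add: reduced_def word_perm_simps)
next
  case (Cons i ws)
  show ?case
  proof (cases "reduced CARD('n) ws")
    case False then show ?thesis using Cons by simp
  next
    case True
    have i: "i \<in> {1..<CARD('n)}" using Cons.prems by simp
    have p: "word_perm ws permutes {1..CARD('n)}" using Cons.prems by (intro word_perm_permutes) simp
    have "descent CARD('n) (word_perm ws) i" using Cons.prems True by (auto simp: reduced_Cons_iff)
    then obtain c where c: "reduced CARD('n) (i # c)" "word_perm (i # c) = word_perm ws"
      using descent_reduced[OF p] by blast
    have "nc_word ws = (nc_word (i # c) :: ('n, 'k) nilcoxeter)"
      by (rule matsumoto[OF True c(1) c(2)[symmetric]])
    then have "nc_word (i # ws) = (nc_T i * nc_T i * nc_word c :: ('n, 'k) nilcoxeter)"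
      by (simp add: mult.assoc)
    then show ?thesis by (simp only: nc_T_square[OF i] mult_zero_left)
  qed
qed

lemma nc_Tw_reduced:
  assumes "reduced CARD('n) ws"
  shows "nc_Tw (word_perm ws) = (nc_word ws :: ('n::finite, 'k::field) nilcoxeter)"
proof -
  have p: "word_perm ws permutes {1..CARD('n)}"
    using assms by (intro word_perm_permutes) (simp add: reduced_def)
  define vs where "vs = (SOME vs. reduced_expression CARD('n) (word_perm ws) vs)"
  have "reduced_expression CARD('n) (word_perm ws) vs"
    unfolding vs_def by (rule someI) (use assms reduced_expression_iff[OF p] in blast)
  then have "reduced CARD('n) vs" "word_perm vs = word_perm ws"
    using reduced_expression_iff[OF p] by blast+
  then show ?thesis unfolding nc_Tw_def vs_def[symmetric] using assms by (intro matsumoto)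
qed

lemma nc_word_eq:
  assumes "set ws \<subseteq> {1..<CARD('n)}"
  shows "nc_word ws = (if reduced CARD('n) ws then nc_Tw (word_perm ws) else
    (0 :: ('n::finite, 'k::field) nilcoxeter))"
  using nc_Tw_reduced[of ws, where 'n = 'n and 'k = 'k] nc_word_not_reduced[OF assms, where 'k = 'k] by auto

lemma nc_Tw_id: "nc_Tw id = (1 :: ('n::finite, 'k::field) nilcoxeter)"
  using nc_Tw_reduced[of "[]", where 'n = 'n and 'k = 'k] by (simp add: reduced_def word_perm_simps)

text \<open>Concatenated reduced words are reduced exactly when the inversion numbers add.\<close>

lemma nc_Tw_mult:
  assumes u: "u permutes {1..CARD('n)}" and w: "w permutes {1..CARD('n)}"
  shows "nc_Tw u * nc_Tw w = (if length_additive CARD('n) u w then nc_Tw (u \<circ> w) else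
    (0 :: ('n::finite, 'k::field) nilcoxeter))"
proof -
  obtain us vs where us: "reduced CARD('n) us" "word_perm us = u"
    and vs: "reduced CARD('n) vs" "word_perm vs = w"
    using reduced_exists[OF u] reduced_exists[OF w] by blast
  have s: "set (us @ vs) \<subseteq> {1..<CARD('n)}" using us vs by (simp add: reduced_def)
  have "nc_Tw u * nc_Tw w = (nc_word (us @ vs) :: ('n, 'k) nilcoxeter)"
    using nc_Tw_reduced[OF us(1), where 'k = 'k] nc_Tw_reduced[OF vs(1), where 'k = 'k] us(2) vs(2) by simp
  moreover have "reduced CARD('n) (us @ vs) \<longleftrightarrow> length_additive CARD('n) u w"
    using us vs s length_additive_iff_ninv[OF u w] by (auto simp: reduced_def word_perm_append)
  ultimately show ?thesis
    using nc_word_eq[OF s, where 'k = 'k] us vs by (simp add: word_perm_append)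
qed

subsection \<open>Coefficients in the standard basis\<close>

lift_definition letters :: "'n::finite gen_word \<Rightarrow> nat list" is "\<lambda>ws. ws" .

lemma letters_add: "letters (u + v) = letters u @ letters v"
  by transfer simp

lemma letters_0: "letters 0 = []"
  by transfer simp

lemma letters_letter: "i \<in> {1..<CARD('n)} \<Longrightarrow> letters (letter i :: 'n::finite gen_word) = [i]"
  by transfer simp

lemma letters_range: "set (letters (u :: 'n::finite gen_word)) \<subseteq> {1..<CARD('n)}"
  by transfer simp

lemma letters_inject: "letters u = letters v \<longleftrightarrow> u = v"
  by transfer simp

definition reduced_word_of :: "(nat \<Rightarrow> nat) \<Rightarrow> 'n::finite gen_word \<Rightarrow> bool" where
  "reduced_word_of w u \<longleftrightarrow> reduced CARD('n) (letters u) \<and> word_perm (letters u) = w"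

text \<open>The functional that is 1 on reduced words of \<open>w\<close> and 0 on all other words,
  extended linearly. It kills the relators and so descends to the coefficient of
  \<open>nc_Tw w\<close>, which shows that these elements are independent.\<close>

definition free_coeff :: "(nat \<Rightarrow> nat) \<Rightarrow> ('n::finite gen_word \<Rightarrow>\<^sub>0 'k::field) \<Rightarrow> 'k" where
  "free_coeff w p = (\<Sum>u\<in>Poly_Mapping.keys p. if reduced_word_of w u then Poly_Mapping.lookup p u else 0)"

lemma free_coeff_superset:
  assumes "finite U" "Poly_Mapping.keys p \<subseteq> U"
  shows "free_coeff w p = (\<Sum>u\<in>U. if reduced_word_of w u then Poly_Mapping.lookup p u else 0)"
  unfolding free_coeff_def by (rule sum.mono_neutral_left) (use assms in \<open>auto simp: in_keys_iff\<close>)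

lemma free_coeff_add: "free_coeff w (p + q) = free_coeff w p + free_coeff w q"
proof -
  define U where "U = Poly_Mapping.keys p \<union> Poly_Mapping.keys q"
  have "finite U" "Poly_Mapping.keys p \<subseteq> U" "Poly_Mapping.keys q \<subseteq> U" "Poly_Mapping.keys (p + q) \<subseteq> U"
    using keys_add[of p q] by (auto simp: U_def)
  then show ?thesis
    by (simp add: free_coeff_superset[of U] lookup_add flip: sum.distrib) (rule sum.cong, auto simp: lookup_add)
qed

lemma free_coeff_0 [simp]: "free_coeff w 0 = 0"
  by (simp add: free_coeff_def)

lemma free_coeff_single: "free_coeff w (Poly_Mapping.single u c) = (if reduced_word_of w u then c else 0)"
  by (subst free_coeff_superset[of "{u}"]) auto

lemma free_coeff_diff: "free_coeff w (p - q) = free_coeff w p - free_coeff w q"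
  using free_coeff_add[of w "p - q" q] by simp

lemma free_coeff_scale: "free_coeff w (free_scale c p) = c * free_coeff w p"
proof (induction p rule: gen_word_poly_induct)
  case (single u d)
  show ?case by (simp add: free_scale_def mult_single free_coeff_single)
next
  case (plus p q)
  then show ?case by (simp add: free_scale_def distrib_left free_coeff_add)
qed (simp add: free_scale_def)

lemma reduced_word_of_cong:
  fixes u v :: "'n::finite gen_word"
  assumes "length (letters u) = length (letters v)" "word_perm (letters u) = word_perm (letters v)"
  shows "reduced_word_of w u \<longleftrightarrow> reduced_word_of w v"
  using assms letters_range[of u] letters_range[of v] by (simp add: reduced_word_of_def reduced_def)

text \<open>The relators are length-homogeneous, so both sides of a braid relation are reduced
  expressions or neither is.\<close>

lemma free_coeff_relator:
  fixes r :: "'n::finite gen_word \<Rightarrow>\<^sub>0 'k::field"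
  assumes "r \<in> nc_relators"
  shows "free_coeff w (Poly_Mapping.single x c * r * Poly_Mapping.single y d) = 0"
proof -
  let ?g = "free_gen :: nat \<Rightarrow> 'n gen_word \<Rightarrow>\<^sub>0 'k" and ?n = "CARD('n)"
  let ?S = "\<lambda>z. Poly_Mapping.single x c * z * Poly_Mapping.single y d"
  consider
    (braid) i where "1 \<le> i" "i + 1 < ?n"
      "r = ?g i * ?g (i + 1) * ?g i - ?g (i + 1) * ?g i * ?g (i + 1)"
  | (comm) i j where "i \<in> {1..<?n}" "j \<in> {1..<?n}" "\<bar>int i - int j\<bar> > 1"
      "r = ?g i * ?g j - ?g j * ?g i"
  | (nil) i where "i \<in> {1..<?n}" "r = ?g i * ?g i"
    using assms unfolding nc_relators_def by blast
  then show ?thesis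
  proof cases
    case braid
    then have "i \<in> {1..<?n}" "Suc i \<in> {1..<?n}" by auto
    note L = letters_letter[OF this(1)] letters_letter[OF this(2)]
    have "reduced_word_of w (x + (letter i + letter (Suc i) + letter i) + y) \<longleftrightarrow>
        reduced_word_of w (x + (letter (Suc i) + letter i + letter (Suc i)) + y)"
      using adj_braid[of i "word_perm (letters y)"]
      by (intro reduced_word_of_cong) (simp_all add: letters_add L word_perm_append word_perm_simps comp_assoc)
    moreover have "?S r = Poly_Mapping.single (x + (letter i + letter (Suc i) + letter i) + y) (c * d)
      - Poly_Mapping.single (x + (letter (Suc i) + letter i + letter (Suc i)) + y) (c * d)"
      unfolding braid by (simp add: free_gen_def mult_single right_diff_distrib left_diff_distrib)
    ultimately show ?thesis by (simp only: free_coeff_diff free_coeff_single) simp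
  next
    case comm
    note L = letters_letter[OF comm(1)] letters_letter[OF comm(2)]
    let ?v = "word_perm (letters y)"
    have "adj i \<circ> (adj j \<circ> ?v) = adj j \<circ> (adj i \<circ> ?v)"
      using comm(3) adj_commute[of i j ?v] adj_commute[of j i ?v] by (cases "i < j") auto
    then have "reduced_word_of w (x + (letter i + letter j) + y) \<longleftrightarrow> reduced_word_of w (x + (letter j + letter i) + y)"
      by (intro reduced_word_of_cong) (simp_all add: letters_add L word_perm_append word_perm_simps comp_assoc)
    moreover have "?S r = Poly_Mapping.single (x + (letter i + letter j) + y) (c * d)
      - Poly_Mapping.single (x + (letter j + letter i) + y) (c * d)"
      unfolding comm by (simp add: free_gen_def mult_single right_diff_distrib left_diff_distrib)
    ultimately show ?thesis by (simp only: free_coeff_diff free_coeff_single) simp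
  next
    case nil
    note L = letters_letter[OF nil(1)]
    have l: "letters (x + (letter i + letter i) + y) = letters x @ i # i # letters y"
      by (simp add: letters_add L)
    have wp: "word_perm (letters x @ i # i # letters y) = word_perm (letters x @ letters y)"
      by (simp add: word_perm_append word_perm_simps)
    \<comment> \<open>Deleting the repeated letter keeps the permutation and shortens the word by
      two, so the long word is not reduced.\<close>
    have "ninv ?n (word_perm (letters x @ letters y)) \<le> length (letters x @ letters y)"
      using letters_range[of x] letters_range[of y] by (intro ninv_word_perm_le) auto
    then have "\<not> reduced_word_of w (x + (letter i + letter i) + y)"
      unfolding reduced_word_of_def l reduced_def wp by simp
    moreover have "?S r = Poly_Mapping.single (x + (letter i + letter i) + y) (c * d)"
      unfolding nil by (simp add: free_gen_def mult_single)
    ultimately show ?thesis by (simp only: free_coeff_single) simp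
  qed
qed

lemma free_coeff_mult_relator:
  fixes r :: "'n::finite gen_word \<Rightarrow>\<^sub>0 'k::field"
  assumes "r \<in> nc_relators" shows "free_coeff w (a * r * b) = 0"
proof (induction a rule: gen_word_poly_induct)
  case (single x c)
  show ?case
    by (induction b rule: gen_word_poly_induct)
      (simp_all add: free_coeff_relator[OF assms] distrib_left free_coeff_add)
qed (simp_all add: distrib_right free_coeff_add)

lemma free_coeff_ideal:
  assumes "x \<in> two_sided_ideal nc_relators" shows "free_coeff w x = 0"
  using assms
  by (induction rule: two_sided_ideal.induct) (simp_all add: free_coeff_add free_coeff_mult_relator)

lift_definition nc_coeff :: "(nat \<Rightarrow> nat) \<Rightarrow> ('n::finite, 'k::field) nilcoxeter \<Rightarrow> 'k" is free_coeff
proof -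
  fix w and p q :: "'n gen_word \<Rightarrow>\<^sub>0 'k" assume "nc_rel p q"
  then have "free_coeff w (p - q) = 0" unfolding nc_rel_def by (rule free_coeff_ideal)
  then show "free_coeff w p = free_coeff w q" by (simp add: free_coeff_diff)
qed

lemma nc_coeff_add: "nc_coeff w (x + y) = nc_coeff w x + nc_coeff w y"
  by transfer (rule free_coeff_add)

lemma nc_coeff_0 [simp]: "nc_coeff w 0 = 0"
  by transfer simp

lemma nc_coeff_diff: "nc_coeff w (x - y) = nc_coeff w x - nc_coeff w y"
  by transfer (rule free_coeff_diff)

lemma nc_coeff_scale: "nc_coeff w (nc_scale c x) = c * nc_coeff w x"
  by transfer (rule free_coeff_scale)

lemma nc_coeff_sum: "nc_coeff w (sum f A) = (\<Sum>a\<in>A. nc_coeff w (f a))"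
  by (induction A rule: infinite_finite_induct) (simp_all add: nc_coeff_add)

definition nc_monomial :: "'n::finite gen_word \<Rightarrow> ('n, 'k::field) nilcoxeter" where
  "nc_monomial u = abs_nilcoxeter (Poly_Mapping.single u 1)"

lemma nc_monomial_add: "nc_monomial (u + v) = nc_monomial u * nc_monomial v"
  by (simp add: nc_monomial_def times_nilcoxeter.abs_eq mult_single)

lemma nc_monomial_0: "nc_monomial 0 = 1"
  by (simp add: nc_monomial_def one_nilcoxeter_def)

lemma nc_monomial_letter: "nc_monomial (letter i) = nc_T i"
  by (simp add: nc_monomial_def nc_T_def free_gen_def)

lemma nc_monomial_eq: "nc_monomial (u :: 'n::finite gen_word) = (nc_word (letters u) :: ('n, 'k::field) nilcoxeter)"
proof (induction "letters u" arbitrary: u)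
  case Nil
  then have "u = 0" by (metis letters_0 letters_inject)
  then show ?case by (simp add: nc_monomial_0 letters_0)
next
  case (Cons i ws)
  have sub: "set (i # ws) \<subseteq> {1..<CARD('n)}" using letters_range[of u] Cons(2) by simp
  then have i: "i \<in> {1..<CARD('n)}" by simp
  define v where "v = (Abs_gen_word ws :: 'n gen_word)"
  have v: "letters v = ws"
    using sub unfolding v_def letters.rep_eq by (intro Abs_gen_word_inverse) simp
  have "letters (letter i + v) = letters u"
    using Cons(2) v by (simp add: letters_add letters_letter[OF i])
  then have "u = letter i + v" by (simp add: letters_inject)
  then show ?case
    using Cons(1)[of v] v by (simp add: nc_monomial_add nc_monomial_letter letters_add letters_letter[OF i])
qed

lemma nc_coeff_monomial: "nc_coeff w (nc_monomial u) = (if reduced_word_of w u then 1 else 0)"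
  by (simp add: nc_monomial_def nc_coeff.abs_eq free_coeff_single)

lemma nc_coeff_Tw:
  assumes "v permutes {1..CARD('n)}"
  shows "nc_coeff w (nc_Tw v :: ('n::finite, 'k::field) nilcoxeter) = (if v = w then 1 else 0)"
proof -
  obtain ws where ws: "reduced CARD('n) ws" "word_perm ws = v" using reduced_exists[OF assms] by blast
  define u where "u = (Abs_gen_word ws :: 'n gen_word)"
  have u: "letters u = ws"
    using ws unfolding u_def letters.rep_eq reduced_def by (intro Abs_gen_word_inverse) simp
  have "nc_Tw v = (nc_monomial u :: ('n, 'k) nilcoxeter)"
    using nc_Tw_reduced[OF ws(1), where 'k = 'k] ws(2) nc_monomial_eq[of u, where 'k = 'k] u by simp
  then show ?thesis using ws u by (simp add: nc_coeff_monomial reduced_word_of_def)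
qed

text \<open>The elements \<open>nc_Tw w\<close> span, because every word is either one of them or
  zero in the quotient.\<close>

lemma nilcoxeter_induct [case_names zero basis add]:
  fixes x :: "('n::finite, 'k::field) nilcoxeter"
  assumes "P 0" and basis: "\<And>c w. w permutes {1..CARD('n)} \<Longrightarrow> P (nc_scale c (nc_Tw w))"
    and add: "\<And>x y. P x \<Longrightarrow> P y \<Longrightarrow> P (x + y)"
  shows "P x"
proof -
  have mono: "P (nc_scale c (nc_monomial u))" for c u
  proof (cases "reduced CARD('n) (letters u)")
    case True
    then have "word_perm (letters u) permutes {1..CARD('n)}"
      using letters_range[of u] by (intro word_perm_permutes)
    then show ?thesis
      using basis nc_word_eq[OF letters_range[of u], where 'k = 'k] True by (simp add: nc_monomial_eq)
  next
    case False
    then show ?thesis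
      using assms(1) nc_word_eq[OF letters_range[of u], where 'k = 'k] by (simp add: nc_monomial_eq)
  qed
  have scale: "abs_nilcoxeter (Poly_Mapping.single u c) = nc_scale c (nc_monomial u)"
    for u :: "'n gen_word" and c :: 'k
    by (simp add: nc_monomial_def nc_scale.abs_eq free_scale_def mult_single)
  have "P (abs_nilcoxeter p)" for p
  proof (induction p rule: gen_word_poly_induct)
    case zero then show ?case using assms(1) by (simp add: zero_nilcoxeter_def)
  next
    case (single u c) then show ?case unfolding scale by (rule mono)
  next
    case (plus p q) then show ?case using add by (simp flip: plus_nilcoxeter.abs_eq)
  qed
  then show ?thesis by (induction x rule: nilcoxeter.abs_induct)
qed

subsection \<open>The twisted trace\<close>

lemma finite_permutes: "finite {w. w permutes {1..n :: nat} \<and> Q w}"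
  using finite_permutations[of "{1..n}"] by (auto intro: finite_subset)

lemma nc_expand:
  "x = (\<Sum>w | w permutes {1..CARD('n)}. nc_scale (nc_coeff w x) (nc_Tw w))"
  for x :: "('n::finite, 'k::field) nilcoxeter"
proof (induction x rule: nilcoxeter_induct)
  case (basis c v)
  let ?P = "{w. w permutes {1..CARD('n)}}"
  have "(\<Sum>w\<in>?P. nc_scale (nc_coeff w (nc_scale c (nc_Tw v :: ('n, 'k) nilcoxeter))) (nc_Tw w)) =
      (\<Sum>w\<in>?P. if v = w then nc_scale c (nc_Tw w :: ('n, 'k) nilcoxeter) else 0)"
    using basis by (intro sum.cong) (simp_all add: nc_coeff_scale nc_coeff_Tw)
  also have "\<dots> = nc_scale c (nc_Tw v)"
    using basis finite_permutations[of "{1..CARD('n)}"] by (simp add: sum.delta')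
  finally show ?case by simp
next
  case (add x y)
  then show ?case
    by (simp add: nc_coeff_add nc.scale_left_distrib sum.distrib)
qed simp

section \<open>The longest element and the trace pairing\<close>

definition rev_perm :: "nat \<Rightarrow> nat \<Rightarrow> nat" where
  "rev_perm n i = (if i \<in> {1..n} then n + 1 - i else i)"

lemma rev_perm_comp [simp]: "rev_perm n \<circ> rev_perm n = id"
  by (rule ext) (auto simp: rev_perm_def)

lemma rev_perm_rev_perm [simp]: "rev_perm n (rev_perm n x) = x"
  by (auto simp: rev_perm_def)

lemma rev_perm_permutes: "rev_perm n permutes {1..n}"
proof (rule bij_imp_permutes)
  show "bij_betw (rev_perm n) {1..n} {1..n}"
    by (rule bij_betw_byWitness[where f' = "rev_perm n"]) (auto simp: rev_perm_def)
qed (auto simp: rev_perm_def)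

lemma inv_rev_perm: "inv (rev_perm n) = rev_perm n"
  by (rule inv_unique_comp) simp_all

lemma rev_perm_less: "a \<in> {1..n} \<Longrightarrow> b \<in> {1..n} \<Longrightarrow> a < b \<Longrightarrow> rev_perm n b < rev_perm n a"
  by (auto simp: rev_perm_def)

text \<open>\<open>rev_perm n\<close> inverts every pair. A permutation of the same length also
  inverts every pair, so its composite with \<open>rev_perm n\<close> is increasing. This uniqueness
  is needed because \<open>arg_max\<close> makes a choice.\<close>

lemma longest_perm_eq: "longest_perm n = rev_perm n"
proof -
  have sub: "inversions n w \<subseteq> inversions n (rev_perm n)" for w
    using rev_perm_less by (auto simp: inversions_def)
  have le: "ninv n w \<le> ninv n (rev_perm n)" for w
    unfolding ninv_def by (rule card_mono[OF finite_inversions sub])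
  have ex: "is_arg_max (perm_length n) (\<lambda>w. w permutes {1..n}) (rev_perm n)"
    unfolding is_arg_max_def
  proof (intro conjI notI rev_perm_permutes, elim exE conjE)
    fix y assume "y permutes {1..n}" "perm_length n (rev_perm n) < perm_length n y"
    then show False using le[of y] by (simp only: perm_length_eq_ninv rev_perm_permutes)
  qed
  have uniq: "w = rev_perm n" if "is_arg_max (perm_length n) (\<lambda>w. w permutes {1..n}) w" for w
  proof -
    have w: "w permutes {1..n}" "\<not> perm_length n (rev_perm n) > perm_length n w"
      using that rev_perm_permutes[of n] by (auto simp: is_arg_max_def)
    then have "card (inversions n w) = card (inversions n (rev_perm n))"
      using le[of w]
      by (simp add: perm_length_eq_ninv[OF w(1)] perm_length_eq_ninv[OF rev_perm_permutes] ninv_def)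
    then have eq: "inversions n w = inversions n (rev_perm n)"
      using card_subset_eq[OF finite_inversions sub] by blast
    have "rev_perm n \<circ> w = id"
    proof (rule increasing_permutation_id)
      show "rev_perm n \<circ> w permutes {1..n}" by (rule permutes_compose[OF w(1) rev_perm_permutes])
      fix i assume i: "i \<in> {1..<n}"
      have "rev_perm n (i + 1) < rev_perm n i" using i by (intro rev_perm_less) auto
      then have "(i, i + 1) \<in> inversions n (rev_perm n)" using i by (auto simp: inversions_def)
      then have "w (i + 1) < w i" unfolding eq[symmetric] by (simp add: inversions_def)
      moreover have "w i \<in> {1..n}" "w (i + 1) \<in> {1..n}"
        using i permutes_in_image[OF w(1)] by auto
      ultimately show "(rev_perm n \<circ> w) i < (rev_perm n \<circ> w) (i + 1)"
        using rev_perm_less by (simp only: comp_apply)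
    qed
    then have "rev_perm n (rev_perm n (w x)) = rev_perm n x" for x by (metis comp_apply id_apply)
    then show ?thesis by auto
  qed
  show ?thesis unfolding longest_perm_def arg_max_def 
    by (rule uniq, rule someI[where P = "is_arg_max (perm_length n) (\<lambda>w. w permutes {1..n})", OF ex])
qed

lemma length_additive_rev_perm:
  assumes "u \<circ> w = rev_perm n" shows "length_additive n u w"
  unfolding length_additive_def
proof (intro ballI impI)
  fix a b assume "a \<in> {1..n}" "b \<in> {1..n}" "a < b"
  then have "(u \<circ> w) b < (u \<circ> w) a" unfolding assms by (rule rev_perm_less)
  then show "u (w b) < u (w a)" by simp
qed

definition nc_trace :: "('n::finite, 'k::field) nilcoxeter \<Rightarrow> 'k" where
  "nc_trace = nc_coeff (rev_perm CARD('n))"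

lemma nc_trace_linear [simp]:
  "nc_trace 0 = 0"
  "nc_trace (x + y) = nc_trace x + nc_trace y"
  "nc_trace (x - y) = nc_trace x - nc_trace y"
  "nc_trace (nc_scale c x) = c * nc_trace x"
  "nc_trace (sum f A) = (\<Sum>a\<in>A. nc_trace (f a))"
  by (simp_all add: nc_trace_def nc_coeff_add nc_coeff_diff nc_coeff_scale nc_coeff_sum)

lemma nc_trace_Tw_mult:
  assumes u: "u permutes {1..CARD('n)}" and w: "w permutes {1..CARD('n)}"
  shows "nc_trace (nc_Tw u * nc_Tw w :: ('n::finite, 'k::field) nilcoxeter) =
    (if u \<circ> w = rev_perm CARD('n) then 1 else 0)"
  using length_additive_rev_perm[of u w "CARD('n)"] permutes_compose[OF w u]
  by (auto simp: nc_Tw_mult[OF u w] nc_trace_def nc_coeff_Tw)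

lemma comp_eq_iff:
  assumes "u permutes S"
  shows "u \<circ> v = p \<longleftrightarrow> v = inv u \<circ> p" "v \<circ> u = p \<longleftrightarrow> v = p \<circ> inv u"
  using permutes_inv_o[OF assms] by (auto simp: comp_assoc simp flip: o_assoc) (metis comp_assoc comp_id id_comp)+

text \<open>Exactly one \<open>v\<close> satisfies \<open>w \<circ> v = rev_perm CARD('n)\<close>,
  so pairing with \<open>nc_Tw w\<close> reads off a single coefficient.\<close>

lemma nc_trace_Tw_left:
  fixes z :: "('n::finite, 'k::field) nilcoxeter" and p :: "nat \<Rightarrow> nat"
  assumes w: "w permutes {1..CARD('n)}" and p: "p = inv w \<circ> rev_perm CARD('n)"
  shows "nc_trace (nc_Tw w * z) = nc_coeff p z"
proof (induction z rule: nilcoxeter_induct)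
  case (basis c v)
  then show ?case
    by (simp add: nc_scale_mult_right nc_trace_Tw_mult[OF w] nc_coeff_scale nc_coeff_Tw comp_eq_iff(1)[OF w] p[symmetric])
next
  case (add x y)
  then show ?case by (simp add: distrib_left nc_coeff_add)
qed simp

lemma nc_trace_nondegenerate:
  fixes z :: "('n::finite, 'k::field) nilcoxeter"
  assumes "\<And>w. w permutes {1..CARD('n)} \<Longrightarrow> nc_trace (nc_Tw w * z) = 0"
  shows "z = 0"
proof -
  have "nc_coeff v z = 0" if v: "v permutes {1..CARD('n)}" for v
  proof -
    \<comment> \<open>The permutation whose pairing reads the coefficient at
      \<open>v\<close>.\<close>
    define w where "w = rev_perm CARD('n) \<circ> inv v"
    have w: "w permutes {1..CARD('n)}"
      unfolding w_def by (rule permutes_compose[OF permutes_inv[OF v] rev_perm_permutes])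
    have "w \<circ> v = rev_perm CARD('n)" by (simp add: w_def comp_assoc permutes_inv_o[OF v])
    then have "v = inv w \<circ> rev_perm CARD('n)" using comp_eq_iff(1)[OF w] by blast
    then show ?thesis using assms[OF w] nc_trace_Tw_left[OF w, of v z] by simp
  qed
  then show ?thesis by (subst nc_expand) simp
qed

section \<open>The flip as conjugation by the longest element\<close>

lemma rev_perm_adj:
  assumes i: "i \<in> {1..<n}"
  shows "adj (n - i) = rev_perm n \<circ> adj i \<circ> rev_perm n"
proof
  fix x
  consider "x \<notin> {1..n}" | "x = n - i" | "x = n - i + 1" | "x \<in> {1..n}" "x \<noteq> n - i" "x \<noteq> n - i + 1"
    by blast
  then show "adj (n - i) x = (rev_perm n \<circ> adj i \<circ> rev_perm n) x"
    by cases (use i in \<open>auto simp: rev_perm_def transpose_def\<close>)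
qed

lemma word_perm_flip_apply:
  assumes "set ws \<subseteq> {1..<n :: nat}"
  shows "word_perm (map (\<lambda>i. n - i) ws) x = rev_perm n (word_perm ws (rev_perm n x))"
  using assms
proof (induction ws)
  case (Cons i ws)
  then have "adj (n - i) = rev_perm n \<circ> adj i \<circ> rev_perm n" by (intro rev_perm_adj) simp
  then show ?case using Cons by (simp add: word_perm_simps)
qed (simp add: word_perm_simps)

lemma word_perm_flip:
  assumes "set ws \<subseteq> {1..<n :: nat}"
  shows "word_perm (map (\<lambda>i. n - i) ws) = rev_perm n \<circ> word_perm ws \<circ> rev_perm n"
  by (rule ext) (simp only: word_perm_flip_apply[OF assms] comp_apply)

text \<open>Flipping a word bounds the length of the conjugate permutation from above; conjugating a
  second time returns to the start, so equality holds.\<close>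

lemma reduced_flip:
  assumes "reduced n ws"
  shows "reduced n (map (\<lambda>i. n - i) ws)"
proof -
  have s: "set ws \<subseteq> {1..<n}" using assms by (simp add: reduced_def)
  then have s': "set (map (\<lambda>i. n - i) ws) \<subseteq> {1..<n}" by (fastforce simp: subset_iff)
  let ?f = "\<lambda>v. rev_perm n \<circ> v \<circ> rev_perm n"
  have le: "ninv n (?f (word_perm vs)) \<le> length vs" if "set vs \<subseteq> {1..<n}" for vs
  proof -
    have "set (map (\<lambda>i. n - i) vs) \<subseteq> {1..<n}" using that by (fastforce simp: subset_iff)
    from ninv_word_perm_le[OF this] show ?thesis by (simp add: word_perm_flip[OF that])
  qed
  have p: "?f (word_perm ws) permutes {1..n}"
    by (intro permutes_compose rev_perm_permutes word_perm_permutes s)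
  obtain vs where vs: "reduced n vs" "word_perm vs = ?f (word_perm ws)"
    using reduced_exists[OF p] by blast
  have "?f (?f (word_perm ws)) = word_perm ws" by (simp add: fun_eq_iff)
  then have "ninv n (word_perm ws) \<le> length vs" using le[of vs] vs by (simp add: reduced_def)
  then have "length ws \<le> ninv n (?f (word_perm ws))" using assms vs by (simp add: reduced_def)
  then show ?thesis using le[OF s] s' by (simp add: reduced_def word_perm_flip[OF s])
qed

lemma nc_flip_word:
  "set ws \<subseteq> {1..<CARD('n)} \<Longrightarrow>
    nc_flip (nc_word ws :: ('n::finite, 'k::field) nilcoxeter) = nc_word (map (\<lambda>i. CARD('n) - i) ws)"
  by (induction ws) (simp_all add: nc_flip_one nc_flip_mult nc_flip_T)

lemma nc_flip_Tw:
  assumes "w permutes {1..CARD('n)}"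
  shows "nc_flip (nc_Tw w :: ('n::finite, 'k::field) nilcoxeter) =
    nc_Tw (rev_perm CARD('n) \<circ> w \<circ> rev_perm CARD('n))"
proof -
  obtain ws where ws: "reduced CARD('n) ws" "word_perm ws = w" using reduced_exists[OF assms] by blast
  then have s: "set ws \<subseteq> {1..<CARD('n)}" by (simp add: reduced_def)
  show ?thesis
    using nc_Tw_reduced[OF ws(1), where 'k = 'k] nc_Tw_reduced[OF reduced_flip[OF ws(1)], where 'k = 'k]
      nc_flip_word[OF s, where 'k = 'k] word_perm_flip[OF s] ws(2) by simp
qed

text \<open>On basis elements both sides test a product for being the longest element, and with
  \<open>v = inv u \<circ> ?r\<close> the factor \<open>?r\<close> cancels in
  \<open>v \<circ> (?r \<circ> u \<circ> ?r)\<close>.\<close>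

lemma nc_trace_twisted:
  fixes a b :: "('n::finite, 'k::field) nilcoxeter"
  shows "nc_trace (a * b) = nc_trace (b * nc_flip a)"
proof (induction a rule: nilcoxeter_induct)
  case zero
  \<comment> \<open>Additivity at zero yields \<open>nc_flip 0 = 0\<close>.\<close>
  have "nc_flip (0 + 0) = nc_flip 0 + (nc_flip 0 :: ('n, 'k) nilcoxeter)" by (rule nc_flip_add)
  then show ?case by simp
next
  case (basis c u)
  let ?r = "rev_perm CARD('n)"
  have fu: "?r \<circ> u \<circ> ?r permutes {1..CARD('n)}"
    by (intro permutes_compose rev_perm_permutes basis)
  have "nc_trace (nc_Tw u * b) = nc_trace (b * nc_flip (nc_Tw u))"
  proof (induction b rule: nilcoxeter_induct)
    case (basis d v)
    have "u \<circ> v = ?r \<longleftrightarrow> v \<circ> (?r \<circ> u \<circ> ?r) = ?r"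
    proof
      assume "u \<circ> v = ?r"
      then have "v = inv u \<circ> ?r" by (simp only: comp_eq_iff[OF \<open>u permutes {1..CARD('n)}\<close>])
      then have "v (?r (u (?r x))) = inv u (u (?r x))" for x by simp
      then show "v \<circ> (?r \<circ> u \<circ> ?r) = ?r"
        by (simp add: fun_eq_iff permutes_inverses[OF \<open>u permutes {1..CARD('n)}\<close>])
    next
      assume eq: "v \<circ> (?r \<circ> u \<circ> ?r) = ?r"
      have h: "v (?r (u (?r x))) = ?r x" for x using fun_cong[OF eq, of x] by simp
      have "v (?r y) = inv u y" for y
        using h[of "?r (inv u y)"] by (simp add: permutes_inverses[OF \<open>u permutes {1..CARD('n)}\<close>])
      from this[of "?r _"] have "v y = inv u (?r y)" for y by simp
      then show "u \<circ> v = ?r"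
        by (simp add: fun_eq_iff permutes_inverses[OF \<open>u permutes {1..CARD('n)}\<close>])
    qed
    then show ?case
      using \<open>u permutes {1..CARD('n)}\<close> basis fu
      by (simp add: nc_scale_mult_left nc_scale_mult_right nc_flip_Tw nc_trace_Tw_mult)
  next
    case (add x y)
    then show ?case by (simp add: distrib_left distrib_right)
  qed simp
  then show ?case by (simp add: nc_scale_mult_left nc_scale_mult_right nc_flip_scale)
next
  case (add x y)
  then show ?case by (simp add: distrib_left distrib_right nc_flip_add)
qed

section \<open>Central elements as functionals on the quotient\<close>

text \<open>The twisted trace turns a twisted commutator against \<open>z\<close> into an ordinary
  commutator of \<open>z\<close> with \<open>nc_flip a\<close>. Nondegeneracy then applies, and
  \<open>nc_flip a\<close> ranges over the whole algebra.\<close>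

lemma nc_center_iff:
  fixes z :: "('n::finite, 'k::field) nilcoxeter"
  shows "z \<in> nc_center \<longleftrightarrow> (\<forall>a b. nc_trace ((a * b - b * nc_flip a) * z) = 0)"
proof -
  have eq: "nc_trace ((a * b - b * nc_flip a) * z) = nc_trace (b * (z * nc_flip a - nc_flip a * z))" for a b
  proof -
    have "nc_trace (a * (b * z)) = nc_trace (b * z * nc_flip a)" by (rule nc_trace_twisted)
    then show ?thesis by (simp add: left_diff_distrib right_diff_distrib mult.assoc)
  qed
  show ?thesis
  proof
    assume "z \<in> nc_center"
    then show "\<forall>a b. nc_trace ((a * b - b * nc_flip a) * z) = 0"
      unfolding eq by (simp add: nc_center_def)
  next
    assume *: "\<forall>a b. nc_trace ((a * b - b * nc_flip a) * z) = 0"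
    have "z * a = a * z" for a
    proof -
      have "z * nc_flip (nc_flip a) - nc_flip (nc_flip a) * z = 0"
        by (rule nc_trace_nondegenerate) (use * in \<open>simp only: eq\<close>)
      then show ?thesis by (simp add: nc_flip_flip)
    qed
    then show "z \<in> nc_center" by (simp add: nc_center_def)
  qed
qed

lemma nc_proj_eq_iff: "nc_proj a = nc_proj b \<longleftrightarrow> a - b \<in> twisted_commutators"
proof -
  have z: "0 \<in> twisted_commutators" unfolding twisted_commutators_def by (rule nc.span_zero)
  have mem: "x \<in> nc_proj y \<longleftrightarrow> x - y \<in> twisted_commutators" for x y :: "('a, 'b) nilcoxeter"
    unfolding nc_proj_def elt_set_plus_def by (auto intro: bexI[of _ "x - y"])
  show ?thesis
  proof
    assume "nc_proj a = nc_proj b"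
    moreover have "a \<in> nc_proj a" using z by (simp add: mem)
    ultimately show "a - b \<in> twisted_commutators" by (simp add: mem)
  next
    assume *: "a - b \<in> twisted_commutators"
    have "x - a \<in> twisted_commutators \<longleftrightarrow> x - b \<in> twisted_commutators" for x
    proof
      assume "x - a \<in> twisted_commutators"
      from nc.span_add[OF this[unfolded twisted_commutators_def] *[unfolded twisted_commutators_def]]
      show "x - b \<in> twisted_commutators" by (simp add: twisted_commutators_def)
    next
      assume "x - b \<in> twisted_commutators"
      from nc.span_diff[OF this[unfolded twisted_commutators_def] *[unfolded twisted_commutators_def]]
      show "x - a \<in> twisted_commutators" by (simp add: twisted_commutators_def)
    qed
    then show "nc_proj a = nc_proj b" by (auto simp: mem)
  qed
qed

lemma nc_center_trace_commutators:
  assumes z: "z \<in> nc_center" and x: "x \<in> twisted_commutators"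
  shows "nc_trace (x * z) = 0"
proof -
  have "nc.subspace {x. nc_trace (x * z) = 0}"
    by (rule nc.subspaceI) (simp_all add: distrib_right nc_scale_mult_left)
  then have "twisted_commutators \<subseteq> {x. nc_trace (x * z) = 0}"
    unfolding twisted_commutators_def
    by (intro nc.span_minimal) (use z nc_center_iff[of z] in auto)
  then show ?thesis using x by blast
qed

text \<open>Duality: through the trace, \<open>nc_z c\<close> is the indicator of the class
  \<open>c\<close> on the standard basis, since the summand of \<open>v\<close> pairs nontrivially
  only with \<open>nc_Tw v\<close>.\<close>

lemma nc_trace_nc_z:
  fixes c :: "('n::finite, 'k::field) nilcoxeter set"
  assumes w: "w permutes {1..CARD('n)}"
  shows "nc_trace (nc_Tw w * nc_z c) = (if nc_proj (nc_Tw w) = c then 1 else 0)"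
proof -
  let ?A = "{v. v permutes {1..CARD('n)} \<and> nc_proj (nc_Tw v :: ('n, 'k) nilcoxeter) = c}"
  have "nc_trace (nc_Tw w * nc_Tw (inv v \<circ> rev_perm CARD('n)) :: ('n, 'k) nilcoxeter) =
      (if w = v then 1 else 0)" if "v \<in> ?A" for v
  proof -
    have v: "v permutes {1..CARD('n)}" using that by simp
    have p: "inv v \<circ> rev_perm CARD('n) permutes {1..CARD('n)}"
      by (intro permutes_compose rev_perm_permutes permutes_inv v)
    have "w \<circ> (inv v \<circ> rev_perm CARD('n)) = rev_perm CARD('n) \<longleftrightarrow> w = v"
    proof
      assume eq: "w \<circ> (inv v \<circ> rev_perm CARD('n)) = rev_perm CARD('n)"
      have "w x = v x" for x
        using fun_cong[OF eq, of "rev_perm CARD('n) (v x)"] by (simp add: permutes_inverses[OF v])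
      then show "w = v" by (simp add: fun_eq_iff)
    next
      assume "w = v"
      then show "w \<circ> (inv v \<circ> rev_perm CARD('n)) = rev_perm CARD('n)"
        by (simp add: fun_eq_iff permutes_inverses[OF v])
    qed
    then show ?thesis by (simp add: nc_trace_Tw_mult[OF w p])
  qed
  then have "nc_trace (nc_Tw w * nc_z c) = (\<Sum>v\<in>?A. if w = v then 1 else 0)"
    unfolding nc_z_def longest_perm_eq sum_distrib_left nc_trace_linear by (rule sum.cong[OF refl])
  moreover have "finite ?A" by (rule finite_permutes)
  ultimately show ?thesis using w by (simp add: sum.delta')
qed

text \<open>A product of basis elements is a basis element or zero, so its pairing with
  \<open>nc_z c\<close> depends only on its class. Vanishing products must pair to 0, which is where
  \<open>c \<noteq> nc_proj 0\<close> enters.\<close>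

lemma nc_z_central:
  fixes c :: "('n::finite, 'k::field) nilcoxeter set"
  assumes "c \<noteq> nc_proj 0"
  shows "nc_z c \<in> nc_center"
  unfolding nc_center_iff
proof (intro allI)
  have tr: "nc_trace (nc_Tw u * nc_Tw v * nc_z c) = (if nc_proj (nc_Tw u * nc_Tw v) = c then 1 else 0)"
    if "u permutes {1..CARD('n)}" "v permutes {1..CARD('n)}" for u v
    using nc_trace_nc_z[OF permutes_compose[OF that(2,1)], of c] assms
    by (auto simp: nc_Tw_mult[OF that])
  fix a b :: "('n, 'k) nilcoxeter"
  show "nc_trace ((a * b - b * nc_flip a) * nc_z c) = 0"
  proof (induction a rule: nilcoxeter_induct)
    case zero
    have "nc_flip (0 + 0) = nc_flip 0 + (nc_flip 0 :: ('n, 'k) nilcoxeter)" by (rule nc_flip_add)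
    then show ?case by simp
  next
    case (basis s u)
    note u = basis
    let ?fu = "rev_perm CARD('n) \<circ> u \<circ> rev_perm CARD('n)"
    have fu: "?fu permutes {1..CARD('n)}"
      by (intro permutes_compose rev_perm_permutes u)
    have "nc_trace ((nc_Tw u * b - b * nc_flip (nc_Tw u)) * nc_z c) = 0"
    proof (induction b rule: nilcoxeter_induct)
      case (basis t v)
      have "nc_Tw u * nc_Tw v - nc_Tw v * nc_flip (nc_Tw u :: ('n, 'k) nilcoxeter) \<in> twisted_commutators"
        unfolding twisted_commutators_def by (rule nc.span_base) blast
      then have "nc_proj (nc_Tw u * nc_Tw v :: ('n, 'k) nilcoxeter) = nc_proj (nc_Tw v * nc_Tw ?fu)"
        by (simp only: nc_proj_eq_iff nc_flip_Tw[OF u])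
      then have "nc_trace (nc_Tw u * nc_Tw v * nc_z c) = nc_trace (nc_Tw v * nc_Tw ?fu * nc_z c)"
        using tr[OF u basis] tr[OF basis fu] by simp
      then show ?case
        by (simp add: nc_scale_mult_left nc_scale_mult_right nc_flip_Tw[OF u] left_diff_distrib)
    next
      case (add x y)
      then show ?case by (simp add: algebra_simps)
    qed simp
    then show ?case
      by (simp add: nc_scale_mult_left nc_scale_mult_right nc_flip_scale left_diff_distrib)
  next
    case (add x y)
    then show ?case by (simp add: algebra_simps nc_flip_add)
  qed
qed

subsection \<open>The center\<close>

lemma nc_coeff_mult_Tw:
  fixes z :: "('n::finite, 'k::field) nilcoxeter" and p q :: "nat \<Rightarrow> nat"
  assumes u: "u permutes {1..CARD('n)}" and q: "q \<circ> u = p"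
  shows "nc_coeff p (z * nc_Tw u) = (if length_additive CARD('n) q u then nc_coeff q z else 0)"
proof (induction z rule: nilcoxeter_induct)
  case (basis c v)
  have "v \<circ> u = p \<longleftrightarrow> v = q"
    using q comp_eq_iff(2)[OF u] by metis
  then show ?case
    using nc_coeff_Tw[OF permutes_compose[OF u basis], where 'k = 'k] nc_coeff_Tw[OF basis, where 'k = 'k]
    by (auto simp: nc_scale_mult_left nc_Tw_mult[OF basis u] nc_coeff_scale)
next
  case (add x y)
  then show ?case by (simp add: distrib_right nc_coeff_add)
qed simp

lemma nc_coeff_Tw_mult:
  fixes z :: "('n::finite, 'k::field) nilcoxeter" and p q :: "nat \<Rightarrow> nat"
  assumes u: "u permutes {1..CARD('n)}" and q: "u \<circ> q = p"
  shows "nc_coeff p (nc_Tw u * z) = (if length_additive CARD('n) u q then nc_coeff q z else 0)"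
proof (induction z rule: nilcoxeter_induct)
  case (basis c v)
  have "u \<circ> v = p \<longleftrightarrow> v = q"
    using q comp_eq_iff(1)[OF u] by metis
  then show ?case
    using nc_coeff_Tw[OF permutes_compose[OF basis u], where 'k = 'k] nc_coeff_Tw[OF basis, where 'k = 'k]
    by (auto simp: nc_scale_mult_right nc_Tw_mult[OF u basis] nc_coeff_scale)
next
  case (add x y)
  then show ?case by (simp add: distrib_left nc_coeff_add)
qed simp

definition nc_support :: "('n::finite, 'k::field) nilcoxeter \<Rightarrow> (nat \<Rightarrow> nat) set" where
  "nc_support z = {w. w permutes {1..CARD('n)} \<and> nc_coeff w z \<noteq> 0}"

lemma stable_nc_support:
  fixes z :: "('n::finite, 'k::field) nilcoxeter"
  assumes "z \<in> nc_center"
  shows "stable CARD('n) (nc_support z)"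
  unfolding stable_def
proof (intro ballI conjI allI impI)
  fix w assume "w \<in> nc_support z"
  then have w: "w permutes {1..CARD('n)}" "nc_coeff w z \<noteq> 0" by (simp_all add: nc_support_def)
  show "w permutes {1..CARD('n)}" by (rule w)
  fix u :: "nat \<Rightarrow> nat" assume u: "u permutes {1..CARD('n)}"
  have comm: "z * nc_Tw u = nc_Tw u * z" using assms by (simp add: nc_center_def)
  have p: "u \<circ> w \<circ> inv u permutes {1..CARD('n)}" "inv u \<circ> w \<circ> u permutes {1..CARD('n)}"
    by (intro permutes_compose permutes_inv u w)+
  {
    assume "length_additive CARD('n) u w"
    \<comment> \<open>In \<open>z * nc_Tw u\<close> the same nonzero coefficient can only come from
      \<open>u \<circ> w \<circ> inv u\<close>.\<close>
    then have "nc_coeff (u \<circ> w) (nc_Tw u * z) \<noteq> 0" using w by (simp add: nc_coeff_Tw_mult[OF u refl])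
    moreover have "u \<circ> w \<circ> inv u \<circ> u = u \<circ> w" by (simp add: comp_assoc permutes_inv_o[OF u])
    ultimately have "length_additive CARD('n) (u \<circ> w \<circ> inv u) u \<and> nc_coeff (u \<circ> w \<circ> inv u) z \<noteq> 0"
      using nc_coeff_mult_Tw[OF u, of "u \<circ> w \<circ> inv u" "u \<circ> w" z] unfolding comm
      by (metis (no_types, lifting))
    then show "u \<circ> w \<circ> inv u \<in> nc_support z" "length_additive CARD('n) (u \<circ> w \<circ> inv u) u"
      using p by (simp_all add: nc_support_def)
  }
  {
    assume "length_additive CARD('n) w u"
    then have "nc_coeff (w \<circ> u) (z * nc_Tw u) \<noteq> 0" using w by (simp add: nc_coeff_mult_Tw[OF u refl])
    moreover have "u \<circ> (inv u \<circ> w \<circ> u) = w \<circ> u"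
      by (simp add: o_assoc permutes_inv_o[OF u])
    ultimately have "length_additive CARD('n) u (inv u \<circ> w \<circ> u) \<and> nc_coeff (inv u \<circ> w \<circ> u) z \<noteq> 0"
      using nc_coeff_Tw_mult[OF u, of "inv u \<circ> w \<circ> u" "w \<circ> u" z] unfolding comm
      by (metis (no_types, lifting))
    then show "inv u \<circ> w \<circ> u \<in> nc_support z" "length_additive CARD('n) u (inv u \<circ> w \<circ> u)"
      using p by (simp_all add: nc_support_def)
  }
qed

lemma nc_mult_eq_0:
  fixes x y :: "('n::finite, 'k::field) nilcoxeter"
  assumes "\<And>u v. u \<in> nc_support x \<Longrightarrow> v \<in> nc_support y \<Longrightarrow> \<not> length_additive CARD('n) u v"
  shows "x * y = 0"
proof -
  let ?P = "{w. w permutes {1..CARD('n)}}"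
  have "nc_scale (nc_coeff u x) (nc_Tw u) * nc_scale (nc_coeff v y) (nc_Tw v) = (0 :: ('n, 'k) nilcoxeter)"
    if "u \<in> ?P" "v \<in> ?P" for u v
  proof (cases "u \<in> nc_support x \<and> v \<in> nc_support y")
    case True
    then show ?thesis
      using assms[of u v] that by (simp add: nc_scale_mult_left nc_scale_mult_right nc_Tw_mult)
  next
    case False
    then show ?thesis using that by (auto simp: nc_support_def nc_scale_mult_left nc_scale_mult_right)
  qed
  then have "(\<Sum>u\<in>?P. nc_scale (nc_coeff u x) (nc_Tw u)) * (\<Sum>v\<in>?P. nc_scale (nc_coeff v y) (nc_Tw v))
      = (0 :: ('n, 'k) nilcoxeter)"
    unfolding sum_product by (intro sum.neutral ballI) blast
  then show ?thesis by (simp only: nc_expand[symmetric])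
qed

text \<open>The supports are stable sets without the identity, so no pair of basis terms multiplies
  to anything nonzero. This covers all central elements without constant term, not only the
  \<open>nc_z c\<close>.\<close>

lemma nc_center_product_zero:
  fixes x y :: "('n::finite, 'k::field) nilcoxeter"
  assumes "x \<in> nc_center" "y \<in> nc_center" "nc_coeff id x = 0" "nc_coeff id y = 0"
  shows "x * y = 0"
proof (rule nc_mult_eq_0)
  fix u v assume uv: "u \<in> nc_support x" "v \<in> nc_support y"
  then have "u \<noteq> id" "v \<noteq> id" using assms(3,4) by (auto simp: nc_support_def)
  then show "\<not> length_additive CARD('n) u v"
    using stable_not_additive[OF stable_nc_support[OF assms(2)] uv(2) _ stable_nc_support[OF assms(1)] uv(1)]
    by blast
qed

section \<open>The basis indexed by classes\<close>

lemma nc_classesE: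
  assumes "c \<in> (nc_classes :: ('n::finite, 'k::field) nilcoxeter set set)"
  obtains w where "w permutes {1..CARD('n)}" "c = nc_proj (nc_Tw w)" "c \<noteq> nc_proj 0"
  using assms by (auto simp: nc_classes_def)

text \<open>As 1 is central, the trace depends only on the class; among the basis elements it is
  nonzero only at the longest one.\<close>

lemma nc_proj_Tw_longest:
  assumes w: "w permutes {1..CARD('n)}"
  shows "nc_proj (nc_Tw w) = nc_proj (nc_Tw (rev_perm CARD('n)) :: ('n::finite, 'k::field) nilcoxeter)
    \<longleftrightarrow> w = rev_perm CARD('n)"
    and "nc_proj (nc_Tw (rev_perm CARD('n))) \<noteq> nc_proj (0 :: ('n::finite, 'k::field) nilcoxeter)"
proof -
  have tr: "nc_trace (nc_Tw v :: ('n, 'k) nilcoxeter) = (if v = rev_perm CARD('n) then 1 else 0)"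
    if "v permutes {1..CARD('n)}" for v
    by (simp add: nc_trace_def nc_coeff_Tw[OF that])
  have one: "(1 :: ('n, 'k) nilcoxeter) \<in> nc_center" by (simp add: nc_center_def)
  have eq: "nc_trace x = nc_trace y" if "nc_proj x = nc_proj y" for x y :: "('n, 'k) nilcoxeter"
    using nc_center_trace_commutators[OF one, of "x - y"] that by (simp add: nc_proj_eq_iff)
  show "nc_proj (nc_Tw w) = nc_proj (nc_Tw (rev_perm CARD('n)) :: ('n, 'k) nilcoxeter)
      \<longleftrightarrow> w = rev_perm CARD('n)"
  proof
    assume "nc_proj (nc_Tw w) = nc_proj (nc_Tw (rev_perm CARD('n)) :: ('n, 'k) nilcoxeter)"
    from eq[OF this] show "w = rev_perm CARD('n)"
      by (simp add: tr[OF w] tr[OF rev_perm_permutes] split: if_splits)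
  qed simp
  show "nc_proj (nc_Tw (rev_perm CARD('n))) \<noteq> nc_proj (0 :: ('n, 'k) nilcoxeter)"
  proof
    assume "nc_proj (nc_Tw (rev_perm CARD('n))) = nc_proj (0 :: ('n, 'k) nilcoxeter)"
    from eq[OF this] show False by (simp add: tr[OF rev_perm_permutes])
  qed
qed

lemma nc_z_longest:
  "nc_z (nc_proj (nc_Tw (rev_perm CARD('n)))) = (1 :: ('n::finite, 'k::field) nilcoxeter)"
proof -
  have "{w. w permutes {1..CARD('n)} \<and>
      nc_proj (nc_Tw w) = nc_proj (nc_Tw (rev_perm CARD('n)) :: ('n, 'k) nilcoxeter)} = {rev_perm CARD('n)}"
    using nc_proj_Tw_longest(1)[where 'n = 'n and 'k = 'k] rev_perm_permutes[of "CARD('n)"] by blast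
  then show ?thesis
    by (simp add: nc_z_def longest_perm_eq inv_rev_perm nc_Tw_id)
qed

text \<open>A central \<open>x\<close> pairs equally with all elements of one class, so it is
  recovered from its values on classes by means of the dual elements \<open>nc_z c\<close>.\<close>

lemma nc_center_span:
  fixes x :: "('n::finite, 'k::field) nilcoxeter"
  assumes x: "x \<in> nc_center"
  shows "x \<in> nc.span (nc_z ` nc_classes)"
proof -
  let ?B = "nc_classes :: ('n, 'k) nilcoxeter set set"
  have "?B \<subseteq> (\<lambda>w. nc_proj (nc_Tw w)) ` {w. w permutes {1..CARD('n)}}"
    by (auto simp: nc_classes_def)
  then have fin: "finite ?B"
    by (rule finite_subset) (intro finite_imageI finite_permutations finite_atLeastAtMost)
  \<comment> \<open>An arbitrary representative of the class serves, because centrality of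
    \<open>x\<close> makes the value independent of it.\<close>
  define g where "g c = nc_trace ((SOME y. nc_proj y = c) * x)" for c
  have cong: "nc_trace (a * x) = nc_trace (b * x)" if "nc_proj a = nc_proj b" for a b
    using nc_center_trace_commutators[OF x, of "a - b"] that
    by (simp add: nc_proj_eq_iff left_diff_distrib)
  have g: "g (nc_proj a) = nc_trace (a * x)" for a
    unfolding g_def by (rule cong) (rule someI[of _ a], rule refl)
  have "x - (\<Sum>c\<in>?B. nc_scale (g c) (nc_z c)) = 0"
  proof (rule nc_trace_nondegenerate)
    fix w assume w: "w permutes {1..CARD('n)}"
    let ?c = "nc_proj (nc_Tw w :: ('n, 'k) nilcoxeter)"
    have "nc_trace (nc_Tw w * (\<Sum>c\<in>?B. nc_scale (g c) (nc_z c))) = (\<Sum>c\<in>?B. if ?c = c then g c else 0)"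
      unfolding sum_distrib_left nc_trace_linear
      by (rule sum.cong) (simp_all add: nc_scale_mult_right nc_trace_nc_z[OF w])
    also have "\<dots> = (if ?c \<in> ?B then g ?c else 0)" by (rule sum.delta'[OF fin])
    also have "\<dots> = nc_trace (nc_Tw w * x)"
    proof (cases "?c \<in> ?B")
      \<comment> \<open>Outside \<open>nc_classes\<close> only the zero class remains, and it pairs
        to 0 with \<open>x\<close>.\<close>
      case False
      then have "?c = nc_proj 0" using w by (auto simp: nc_classes_def)
      from cong[OF this] show ?thesis using False by simp
    qed (simp add: g)
    finally show "nc_trace (nc_Tw w * (x - (\<Sum>c\<in>?B. nc_scale (g c) (nc_z c)))) = 0"
      by (simp only: right_diff_distrib nc_trace_linear) simp
  qed
  then have "x = (\<Sum>c\<in>?B. nc_scale (g c) (nc_z c))" by simp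
  also have "\<dots> \<in> nc.span (nc_z ` ?B)"
    by (intro nc.span_sum nc.span_scale nc.span_base imageI)
  finally show ?thesis .
qed

lemma nc_z_inj_on: "inj_on nc_z (nc_classes :: ('n::finite, 'k::field) nilcoxeter set set)"
proof (rule inj_onI)
  fix c c' :: "('n, 'k) nilcoxeter set"
  assume c: "c \<in> nc_classes" and eq: "nc_z c = nc_z c'"
  obtain w where w: "w permutes {1..CARD('n)}" "c = nc_proj (nc_Tw w)" using c by (rule nc_classesE)
  show "c = c'"
    using nc_trace_nc_z[OF w(1), of c] nc_trace_nc_z[OF w(1), of c'] w(2) eq by (auto split: if_splits)
qed

text \<open>Pairing a vanishing combination with \<open>nc_Tw w\<close>, for \<open>w\<close> in the
  class \<open>c\<close>, isolates the scalar at \<open>nc_z c\<close>.\<close>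

lemma nc_z_independent: "nc.independent (nc_z ` (nc_classes :: ('n::finite, 'k::field) nilcoxeter set set))"
  unfolding nc.independent_explicit_module
proof (intro allI impI)
  fix t u and x :: "('n, 'k) nilcoxeter"
  assume t: "finite t" "t \<subseteq> nc_z ` nc_classes" "(\<Sum>v\<in>t. nc_scale (u v) v) = 0" "x \<in> t"
  obtain c where c: "c \<in> nc_classes" "x = nc_z c" using t by blast
  obtain w where w: "w permutes {1..CARD('n)}" "c = nc_proj (nc_Tw w)" using c(1) by (rule nc_classesE)
  have "nc_trace (nc_Tw w * v) = (if x = v then 1 else 0)" if v: "v \<in> t" for v
  proof -
    obtain c' where c': "c' \<in> nc_classes" "v = nc_z c'" using t(2) v by blast
    have "x = v \<longleftrightarrow> c = c'" using inj_onD[OF nc_z_inj_on] c c' by blast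
    then show ?thesis using nc_trace_nc_z[OF w(1), of c'] w(2) c'(2) by simp
  qed
  then have "(\<Sum>v\<in>t. u v * nc_trace (nc_Tw w * v)) = (\<Sum>v\<in>t. if x = v then u v else 0)"
    by (intro sum.cong) auto
  also have "\<dots> = u x" using t by (simp add: sum.delta')
  finally have "u x = nc_trace (nc_Tw w * (\<Sum>v\<in>t. nc_scale (u v) v))"
    unfolding sum_distrib_left nc_trace_linear by (simp add: nc_scale_mult_right)
  then show "u x = 0" using t(3) by simp
qed

text \<open>The coefficient at \<open>id\<close> is the pairing with the longest basis element,
  nonzero only for the class of that element, whose \<open>nc_z\<close> is 1.\<close>

lemma nc_coeff_id_nc_z:
  fixes c :: "('n::finite, 'k::field) nilcoxeter set"
  assumes "nc_z c \<noteq> 1"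
  shows "nc_coeff id (nc_z c) = 0"
proof -
  have "id = inv (rev_perm CARD('n)) \<circ> rev_perm CARD('n)" by (simp add: inv_rev_perm)
  from nc_trace_Tw_left[OF rev_perm_permutes this, of "nc_z c"]
  have "nc_coeff id (nc_z c) = nc_trace (nc_Tw (rev_perm CARD('n)) * nc_z c)" by simp
  moreover have "c \<noteq> nc_proj (nc_Tw (rev_perm CARD('n)))" using assms nc_z_longest by blast
  ultimately show ?thesis using nc_trace_nc_z[OF rev_perm_permutes, of c] by auto
qed

theorem proposition4p2:
  fixes B :: "('n::finite, 'k::field) nilcoxeter set set"
    and z :: "('n, 'k) nilcoxeter set \<Rightarrow> ('n, 'k) nilcoxeter"
  assumes "B = nc_classes" and "z = nc_z"
  shows "inj_on z B \<and> nc.independent (z ` B) \<and> nc.span (z ` B) = nc_center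
    \<and> nc_proj (nc_Tw (longest_perm CARD('n))) \<in> B
    \<and> z (nc_proj (nc_Tw (longest_perm CARD('n)))) = 1
    \<and> (\<forall>c\<in>B. \<forall>c'\<in>B. z c \<noteq> 1 \<longrightarrow> z c' \<noteq> 1 \<longrightarrow> z c * z c' = 0)"
  unfolding assms longest_perm_eq
proof (intro conjI ballI impI)
  let ?B = "nc_classes :: ('n, 'k) nilcoxeter set set"
  have central: "nc_z c \<in> nc_center" if "c \<in> ?B" for c
    using that by (elim nc_classesE) (rule nc_z_central)
  show "inj_on nc_z ?B" by (rule nc_z_inj_on)
  show "nc.independent (nc_z ` ?B)" by (rule nc_z_independent)
  have "nc.subspace (nc_center :: ('n, 'k) nilcoxeter set)"
    by (rule nc.subspaceI)
      (simp_all add: nc_center_def distrib_left distrib_right nc_scale_mult_left nc_scale_mult_right)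
  then have "nc.span (nc_z ` ?B) \<subseteq> nc_center"
    using central by (intro nc.span_minimal) auto
  then show "nc.span (nc_z ` ?B) = nc_center" using nc_center_span by blast
  show "nc_proj (nc_Tw (rev_perm CARD('n))) \<in> ?B"
    using nc_proj_Tw_longest(2)[OF rev_perm_permutes] rev_perm_permutes[of "CARD('n)"]
    unfolding nc_classes_def by blast
  show "nc_z (nc_proj (nc_Tw (rev_perm CARD('n)))) = (1 :: ('n, 'k) nilcoxeter)"
    by (rule nc_z_longest)
  fix c c' :: "('n, 'k) nilcoxeter set"
  assume "c \<in> ?B" "c' \<in> ?B" "nc_z c \<noteq> 1" "nc_z c' \<noteq> 1"
  then show "nc_z c * nc_z c' = 0"
    by (intro nc_center_product_zero central nc_coeff_id_nc_z)
qed

end
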